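(* Let $(W,S)$ be a finite Coxeter system with set of reflections $T$, let $k\in\mathbb{Z}_{\geq 0}$, and let $w=t_1\cdots t_{m+2k}\in W$ with $t_1,\dots,t_{m+2k}\in T$ be a reflection factorization, where $m=\ell_T(w)$. Then there exist a braid $\sigma\in\mathcal{B}_{m+2k}$ and reflections $r_1,\dots,r_m,r_{i_1},\dots,r_{i_k}\in T$ (the $r_{i_j}$ not being required to occur among $r_1,\dots,r_m$) such that $$\sigma(t_1,\dots,t_{m+2k})=(r_1,\dots,r_m,r_{i_1},r_{i_1},\dots,r_{i_k},r_{i_k}).$$
   Context: For a Coxeter system $(W,S)$, $T=\{wsw^{-1}\mid w\in W,\ s\in S\}$ is its set of reflections. The reflection length $\ell_T(w)$ of $w \in W$ is the smallest $m$ such that $w$ is a product of $m$ elements of $T$. A reflection factorization of $w$ is an expression $w=t_1\cdots t_m$ with $t_i\in T$, also identified with the tuple $(t_1,\dots,t_m)\in T^m$. The braid group on $m$ strands $\mathcal{B}_m=\langle \sigma_1,\dots,\sigma_{m-1}\mid \sigma_i\sigma_{i+1}\sigma_i=\sigma_{i+1}\sigma_i\sigma_{i+1},\ \sigma_i\sigma_j=\sigma_j\sigma_i\ (|i-j|>1)\rangle$ acts on $T^m$ (Hurwitz action) by $$\sigma_i(t_1,\dots,t_m)=(t_1,\dots,t_{i-1},t_it_{i+1}t_i,t_i,t_{i+2},\dots,t_m),$$ $$\sigma_i^{-1}(t_1,\dots,t_m)=(t_1,\dots,t_{i-1},t_{i+1},t_{i+1}t_it_{i+1},t_{i+2},\dots,t_m).$$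 *)

theory Defs
  imports "HOL-Algebra.Group"
begin

section \<open>Groups given by generators and relations\<close>

text \<open>A letter \<open>(x, True)\<close> stands for the generator \<open>x\<close>, a letter \<open>(x, False)\<close> for its formal
  inverse. A relation \<open>l = r\<close> is a pair \<open>(l, r)\<close> of words.\<close>

type_synonym 'x gword = "('x \<times> bool) list"

abbreviation gwords :: "'x set \<Rightarrow> 'x gword set" where
  "gwords S \<equiv> lists (S \<times> UNIV)"

inductive_set presentation_rel :: "'x set \<Rightarrow> ('x gword \<times> 'x gword) set \<Rightarrow> ('x gword \<times> 'x gword) set"
  for S :: "'x set" and R :: "('x gword \<times> 'x gword) set" where
  refl: "u \<in> gwords S \<Longrightarrow> (u, u) \<in> presentation_rel S R"
| sym: "(u, v) \<in> presentation_rel S R \<Longrightarrow> (v, u) \<in> presentation_rel S R"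
| trans: "(u, v) \<in> presentation_rel S R \<Longrightarrow> (v, w) \<in> presentation_rel S R \<Longrightarrow>
    (u, w) \<in> presentation_rel S R"
| cancel: "p \<in> gwords S \<Longrightarrow> q \<in> gwords S \<Longrightarrow> x \<in> S \<Longrightarrow>
    (p @ [(x, e), (x, \<not> e)] @ q, p @ q) \<in> presentation_rel S R"
| relation: "p \<in> gwords S \<Longrightarrow> q \<in> gwords S \<Longrightarrow> (l, r) \<in> R \<Longrightarrow>
    l \<in> gwords S \<Longrightarrow> r \<in> gwords S \<Longrightarrow> (p @ l @ q, p @ r @ q) \<in> presentation_rel S R"

abbreviation presentation_class ::
    "'x set \<Rightarrow> ('x gword \<times> 'x gword) set \<Rightarrow> 'x gword \<Rightarrow> 'x gword set" where
  "presentation_class S R u \<equiv> presentation_rel S R `` {u}"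

definition presented_group :: "'x set \<Rightarrow> ('x gword \<times> 'x gword) set \<Rightarrow> 'x gword set monoid" where
  "presented_group S R =
    \<lparr>carrier = gwords S // presentation_rel S R,
     mult = (\<lambda>A B. \<Union>u\<in>A. \<Union>v\<in>B. presentation_class S R (u @ v)),
     one = presentation_class S R []\<rparr>"

lemma presentation_rel_words:
  "(u, v) \<in> presentation_rel S R \<Longrightarrow> u \<in> gwords S \<and> v \<in> gwords S"
  by (induction rule: presentation_rel.induct) auto

lemma equiv_presentation_rel: "equiv (gwords S) (presentation_rel S R)"
proof (rule equivI)
  show "presentation_rel S R \<subseteq> gwords S \<times> gwords S"
    using presentation_rel_words by fast
  show "refl_on (gwords S) (presentation_rel S R)"
    by (rule refl_onI) (auto intro: presentation_rel.refl dest: presentation_rel_words)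
  show "Relation.sym (presentation_rel S R)"
    by (rule symI) (rule presentation_rel.sym)
  show "Relation.trans (presentation_rel S R)"
    by (rule transI) (rule presentation_rel.trans)
qed

lemma presentation_rel_context:
  "(u, v) \<in> presentation_rel S R \<Longrightarrow> a \<in> gwords S \<Longrightarrow> b \<in> gwords S \<Longrightarrow>
    (a @ u @ b, a @ v @ b) \<in> presentation_rel S R"
proof (induction rule: presentation_rel.induct)
  case (cancel p q x e)
  then show ?case
    using presentation_rel.cancel[of "a @ p" S "q @ b" x e R] by simp
next
  case (relation p q l r)
  then show ?case
    using presentation_rel.relation[of "a @ p" S "q @ b" l r R] by simp
next
  case (refl u)
  then show ?case
    using presentation_rel.refl[of "a @ u @ b" S R] by simp
next
  case (sym u v)
  then show ?case by (blast intro: presentation_rel.sym)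
next
  case (trans u v w)
  then show ?case by (blast intro: presentation_rel.trans)
qed

lemma presentation_rel_append:
  assumes "(u, u') \<in> presentation_rel S R" "(v, v') \<in> presentation_rel S R"
  shows "(u @ v, u' @ v') \<in> presentation_rel S R"
proof (rule presentation_rel.trans)
  show "(u @ v, u' @ v) \<in> presentation_rel S R"
    using presentation_rel_context[OF assms(1), of "[]" v] presentation_rel_words[OF assms(2)] by simp
  show "(u' @ v, u' @ v') \<in> presentation_rel S R"
    using presentation_rel_context[OF assms(2), of u' "[]"] presentation_rel_words[OF assms(1)] by simp
qed

lemma presented_group_mult:
  assumes "u \<in> gwords S" "v \<in> gwords S"
  shows "presentation_class S R u \<otimes>\<^bsub>presented_group S R\<^esub> presentation_class S R v
    = presentation_class S R (u @ v)"
proof -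
  let ?A = "presentation_class S R u" and ?B = "presentation_class S R v"
  have eq: "presentation_class S R (u' @ v') = presentation_class S R (u @ v)"
    if "u' \<in> ?A" "v' \<in> ?B" for u' v'
  proof -
    have "(u @ v, u' @ v') \<in> presentation_rel S R"
      using that by (intro presentation_rel_append) simp_all
    then show ?thesis
      by (rule equiv_class_eq[OF equiv_presentation_rel, symmetric])
  qed
  have "(\<Union>u'\<in>?A. \<Union>v'\<in>?B. presentation_class S R (u' @ v'))
    = (\<Union>u'\<in>?A. \<Union>v'\<in>?B. presentation_class S R (u @ v))"
    by (intro SUP_cong HOL.refl eq)
  also have "\<dots> = presentation_class S R (u @ v)"
  proof -
    have "u \<in> ?A" "v \<in> ?B"
      using assms by (auto intro: presentation_rel.refl)
    then show ?thesis by blast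
  qed
  finally show ?thesis
    by (simp add: presented_group_def)
qed

lemma gwords_inverse: "u \<in> gwords S \<Longrightarrow> rev (map (apsnd Not) u) \<in> gwords S"
  by (induction u) auto

lemma presentation_rel_inverse:
  assumes "u \<in> gwords S"
  shows "(rev (map (apsnd Not) u) @ u, []) \<in> presentation_rel S R"
  using assms
proof (induction u rule: list.induct)
  case Nil
  then show ?case by (auto intro: presentation_rel.refl)
next
  case (Cons a u)
  obtain x e where a: "a = (x, e)" by fastforce
  let ?v = "rev (map (apsnd Not) u)"
  have v: "?v \<in> gwords S" using Cons.prems gwords_inverse[of u S] by simp
  have "(?v @ [(x, \<not> e), (x, \<not> \<not> e)] @ u, ?v @ u) \<in> presentation_rel S R"
    using Cons.prems v a by (intro presentation_rel.cancel) auto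
  then show ?case
    using presentation_rel.trans Cons a by fastforce
qed

lemma group_presented_group: "group (presented_group S R)"
proof (rule groupI)
  let ?G = "presented_group S R"
  have rep: "\<exists>u\<in>gwords S. A = presentation_class S R u" if "A \<in> carrier ?G" for A
    using that by (auto simp: presented_group_def elim!: quotientE)
  have cls: "presentation_class S R u \<in> carrier ?G" if "u \<in> gwords S" for u
    using that by (simp add: presented_group_def quotientI)
  have one: "\<one>\<^bsub>?G\<^esub> = presentation_class S R []" by (simp add: presented_group_def)
  show "A \<otimes>\<^bsub>?G\<^esub> B \<in> carrier ?G" if A: "A \<in> carrier ?G" and B: "B \<in> carrier ?G" for A B
  proof -
    obtain u v where "u \<in> gwords S" "v \<in> gwords S"
      and "A = presentation_class S R u" "B = presentation_class S R v"
      using rep[OF A] rep[OF B] by blast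
    then show ?thesis
      by (simp add: presented_group_mult cls append_in_lists_conv del: in_lists_conv_set)
  qed
  show "\<one>\<^bsub>?G\<^esub> \<in> carrier ?G" by (simp add: one cls)
  show "A \<otimes>\<^bsub>?G\<^esub> B \<otimes>\<^bsub>?G\<^esub> C = A \<otimes>\<^bsub>?G\<^esub> (B \<otimes>\<^bsub>?G\<^esub> C)"
    if A: "A \<in> carrier ?G" and B: "B \<in> carrier ?G" and C: "C \<in> carrier ?G" for A B C
  proof -
    obtain u v w where "u \<in> gwords S" "v \<in> gwords S" "w \<in> gwords S"
      and "A = presentation_class S R u" "B = presentation_class S R v" "C = presentation_class S R w"
      using rep[OF A] rep[OF B] rep[OF C] by blast
    then show ?thesis
      by (simp add: presented_group_mult append_in_lists_conv del: in_lists_conv_set)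
  qed
  show "\<one>\<^bsub>?G\<^esub> \<otimes>\<^bsub>?G\<^esub> A = A" if A: "A \<in> carrier ?G" for A
  proof -
    obtain u where "u \<in> gwords S" "A = presentation_class S R u" using rep[OF A] by blast
    then show ?thesis
      using presented_group_mult[of "[]" S u R] by (simp add: one)
  qed
  show "\<exists>B\<in>carrier ?G. B \<otimes>\<^bsub>?G\<^esub> A = \<one>\<^bsub>?G\<^esub>" if A: "A \<in> carrier ?G" for A
  proof -
    obtain u where u: "u \<in> gwords S" "A = presentation_class S R u" using rep[OF A] by blast
    let ?v = "rev (map (apsnd Not) u)"
    have v: "?v \<in> gwords S" using u(1) by (rule gwords_inverse)
    have "presentation_class S R (?v @ u) = presentation_class S R []"
      using equiv_class_eq[OF equiv_presentation_rel] presentation_rel_inverse[OF u(1)] by metis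
    then have "presentation_class S R ?v \<otimes>\<^bsub>?G\<^esub> A = \<one>\<^bsub>?G\<^esub>"
      using presented_group_mult[OF v u(1), of R] by (simp add: u(2) one)
    then show ?thesis using cls[OF v] by blast
  qed
qed

section \<open>Coxeter systems\<close>

text \<open>The entry \<open>0\<close> of a Coxeter matrix encodes \<open>\<infinity>\<close>; the corresponding relation below then reads
  \<open>[] = []\<close> and is vacuous.\<close>

definition coxeter_matrix :: "'s set \<Rightarrow> ('s \<Rightarrow> 's \<Rightarrow> nat) \<Rightarrow> bool" where
  "coxeter_matrix S M \<longleftrightarrow>
    (\<forall>s\<in>S. M s s = 1) \<and> (\<forall>s\<in>S. \<forall>t\<in>S. M s t = M t s \<and> (s \<noteq> t \<longrightarrow> M s t = 0 \<or> M s t \<ge> 2))"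

definition coxeter_relations ::
    "'s set \<Rightarrow> ('s \<Rightarrow> 's \<Rightarrow> nat) \<Rightarrow> ('s gword \<times> 's gword) set" where
  "coxeter_relations S M =
    {(concat (replicate (M s t) [(s, True), (t, True)]), []) | s t. s \<in> S \<and> t \<in> S}"

definition coxeter_system :: "('a, 'b) monoid_scheme \<Rightarrow> 'a set \<Rightarrow> bool" where
  "coxeter_system W S \<longleftrightarrow> group W \<and> S \<subseteq> carrier W \<and>
    (\<exists>M. coxeter_matrix S M \<and>
      (\<exists>\<phi>\<in>iso (presented_group S (coxeter_relations S M)) W.
        \<forall>s\<in>S. \<phi> (presentation_class S (coxeter_relations S M) [(s, True)]) = s))"

definition reflections :: "('a, 'b) monoid_scheme \<Rightarrow> 'a set \<Rightarrow> 'a set" where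
  "reflections W S = {w \<otimes>\<^bsub>W\<^esub> s \<otimes>\<^bsub>W\<^esub> inv\<^bsub>W\<^esub> w | w s. w \<in> carrier W \<and> s \<in> S}"

definition list_product :: "('a, 'b) monoid_scheme \<Rightarrow> 'a list \<Rightarrow> 'a" where
  "list_product W ts = foldr (\<otimes>\<^bsub>W\<^esub>) ts \<one>\<^bsub>W\<^esub>"

definition reflection_factorization ::
    "('a, 'b) monoid_scheme \<Rightarrow> 'a set \<Rightarrow> 'a \<Rightarrow> 'a list \<Rightarrow> bool" where
  "reflection_factorization W S w ts \<longleftrightarrow> set ts \<subseteq> reflections W S \<and> list_product W ts = w"

definition reflection_length :: "('a, 'b) monoid_scheme \<Rightarrow> 'a set \<Rightarrow> 'a \<Rightarrow> nat" where
  "reflection_length W S w = (LEAST m. \<exists>ts. length ts = m \<and> reflection_factorization W S w ts)"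

section \<open>Braid groups and the Hurwitz action\<close>

definition braid_relations :: "nat \<Rightarrow> (nat gword \<times> nat gword) set" where
  "braid_relations n =
    {([(i, True), (i + 1, True), (i, True)], [(i + 1, True), (i, True), (i + 1, True)]) | i.
      1 \<le> i \<and> i + 1 < n} \<union>
    {([(i, True), (j, True)], [(j, True), (i, True)]) | i j.
      i \<in> {1..<n} \<and> j \<in> {1..<n} \<and> (i + 1 < j \<or> j + 1 < i)}"

definition braid_group :: "nat \<Rightarrow> nat gword set monoid" where
  "braid_group n = presented_group {1..<n} (braid_relations n)"

text \<open>The indices \<open>i\<close> of the generators start at \<open>1\<close> while list positions start at \<open>0\<close>, so the pair
  \<open>(t\<^sub>i, t\<^sub>i\<^sub>+\<^sub>1)\<close> sits at the positions \<open>i - 1\<close> and \<open>i\<close>.\<close>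

definition hurwitz_gen :: "('a, 'b) monoid_scheme \<Rightarrow> nat \<Rightarrow> 'a list \<Rightarrow> 'a list" where
  "hurwitz_gen W i ts =
    ts[i - 1 := ts ! (i - 1) \<otimes>\<^bsub>W\<^esub> ts ! i \<otimes>\<^bsub>W\<^esub> ts ! (i - 1), i := ts ! (i - 1)]"

definition hurwitz_gen_inv :: "('a, 'b) monoid_scheme \<Rightarrow> nat \<Rightarrow> 'a list \<Rightarrow> 'a list" where
  "hurwitz_gen_inv W i ts =
    ts[i - 1 := ts ! i, i := ts ! i \<otimes>\<^bsub>W\<^esub> ts ! (i - 1) \<otimes>\<^bsub>W\<^esub> ts ! i]"

definition hurwitz_word :: "('a, 'b) monoid_scheme \<Rightarrow> nat gword \<Rightarrow> 'a list \<Rightarrow> 'a list" where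
  "hurwitz_word W u ts =
    foldr (\<lambda>(i, e). if e then hurwitz_gen W i else hurwitz_gen_inv W i) u ts"

text \<open>A braid is a class of words, all of which transform a tuple of \<open>n\<close> reflections in the same way
  (lemma \<open>hurwitz_action_eq\<close> below); \<open>hurwitz_action\<close> returns this common value.\<close>

definition hurwitz_action :: "('a, 'b) monoid_scheme \<Rightarrow> nat gword set \<Rightarrow> 'a list \<Rightarrow> 'a list" where
  "hurwitz_action W \<sigma> ts = (THE us. \<forall>u\<in>\<sigma>. hurwitz_word W u ts = us)"

lemma hurwitz_word_simps [simp]:
  "hurwitz_word W [] ts = ts"
  "hurwitz_word W ((i, True) # u) ts = hurwitz_gen W i (hurwitz_word W u ts)"
  "hurwitz_word W ((i, False) # u) ts = hurwitz_gen_inv W i (hurwitz_word W u ts)"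
  "hurwitz_word W (u @ v) ts = hurwitz_word W u (hurwitz_word W v ts)"
  by (simp_all add: hurwitz_word_def)

lemma coxeter_generator_square:
  assumes "coxeter_system W S" "s \<in> S"
  shows "s \<otimes>\<^bsub>W\<^esub> s = \<one>\<^bsub>W\<^esub>"
proof -
  obtain M \<phi> where M: "coxeter_matrix S M" and
    \<phi>: "\<phi> \<in> iso (presented_group S (coxeter_relations S M)) W"
    and \<phi>s: "\<forall>s\<in>S. \<phi> (presentation_class S (coxeter_relations S M) [(s, True)]) = s"
    and W: "group W"
    using assms(1) unfolding coxeter_system_def by blast
  let ?R = "coxeter_relations S M"
  let ?G = "presented_group S ?R"
  let ?c = "presentation_class S ?R [(s, True)]"
  have sw: "[(s, True)] \<in> gwords S" using assms(2) by simp
  have c: "?c \<in> carrier ?G" using sw by (simp add: presented_group_def quotientI)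
  have "([(s, True), (s, True)], []) \<in> ?R"
    using M assms(2) unfolding coxeter_relations_def coxeter_matrix_def
    by (auto intro!: exI[of _ s])
  then have "([(s, True), (s, True)], []) \<in> presentation_rel S ?R"
    using presentation_rel.relation[of "[]" S "[]" "[(s, True), (s, True)]" "[]" ?R] assms(2) by auto
  then have "?c \<otimes>\<^bsub>?G\<^esub> ?c = \<one>\<^bsub>?G\<^esub>"
    using equiv_class_eq[OF equiv_presentation_rel] presented_group_mult[OF sw sw, of ?R]
    by (simp add: presented_group_def)
  moreover have "\<phi> (?c \<otimes>\<^bsub>?G\<^esub> ?c) = s \<otimes>\<^bsub>W\<^esub> s"
    using \<phi> c \<phi>s assms(2) by (auto simp: iso_def hom_def)
  ultimately show ?thesis
    using hom_one[OF _ group_presented_group W] \<phi> by (metis (no_types, lifting) iso_imp_homomorphism)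
qed

lemma reflections_carrier:
  assumes "coxeter_system W S" "t \<in> reflections W S"
  shows "t \<in> carrier W"
proof -
  interpret group W using assms(1) by (simp add: coxeter_system_def)
  show ?thesis using assms by (auto simp: reflections_def coxeter_system_def)
qed

lemma reflections_square:
  assumes "coxeter_system W S" "t \<in> reflections W S"
  shows "t \<otimes>\<^bsub>W\<^esub> t = \<one>\<^bsub>W\<^esub>"
proof -
  interpret group W using assms(1) by (simp add: coxeter_system_def)
  obtain w s where w: "w \<in> carrier W" and s: "s \<in> S" and t: "t = w \<otimes>\<^bsub>W\<^esub> s \<otimes>\<^bsub>W\<^esub> inv\<^bsub>W\<^esub> w"
    using assms(2) by (auto simp: reflections_def)
  have sc: "s \<in> carrier W" using assms(1) s by (auto simp: coxeter_system_def)
  have "inv\<^bsub>W\<^esub> w \<otimes>\<^bsub>W\<^esub> (w \<otimes>\<^bsub>W\<^esub> x) = x" if "x \<in> carrier W" for x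
    using w that by (simp flip: m_assoc)
  then have "t \<otimes>\<^bsub>W\<^esub> t = w \<otimes>\<^bsub>W\<^esub> (s \<otimes>\<^bsub>W\<^esub> s) \<otimes>\<^bsub>W\<^esub> inv\<^bsub>W\<^esub> w"
    using w sc by (simp add: t m_assoc)
  then show ?thesis using w coxeter_generator_square[OF assms(1) s] by simp
qed

lemma reflections_conj:
  assumes "coxeter_system W S" "t \<in> reflections W S" "r \<in> reflections W S"
  shows "t \<otimes>\<^bsub>W\<^esub> r \<otimes>\<^bsub>W\<^esub> t \<in> reflections W S"
proof -
  interpret group W using assms(1) by (simp add: coxeter_system_def)
  obtain w s where w: "w \<in> carrier W" and s: "s \<in> S" and r: "r = w \<otimes>\<^bsub>W\<^esub> s \<otimes>\<^bsub>W\<^esub> inv\<^bsub>W\<^esub> w"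
    using assms(3) by (auto simp: reflections_def)
  have sc: "s \<in> carrier W" using assms(1) s by (auto simp: coxeter_system_def)
  have tc: "t \<in> carrier W" using reflections_carrier[OF assms(1,2)] .
  have ti: "inv\<^bsub>W\<^esub> t = t" using reflections_square[OF assms(1,2)] tc inv_equality by metis
  have "t \<otimes>\<^bsub>W\<^esub> r \<otimes>\<^bsub>W\<^esub> t = (t \<otimes>\<^bsub>W\<^esub> w) \<otimes>\<^bsub>W\<^esub> s \<otimes>\<^bsub>W\<^esub> inv\<^bsub>W\<^esub> (t \<otimes>\<^bsub>W\<^esub> w)"
    using w sc tc by (simp add: r m_assoc inv_mult_group ti)
  then show ?thesis using w s tc unfolding reflections_def by blast
qed

definition reflection_tuples :: "('a, 'b) monoid_scheme \<Rightarrow> 'a set \<Rightarrow> nat \<Rightarrow> 'a list set" where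
  "reflection_tuples W S n = {ts. length ts = n \<and> set ts \<subseteq> reflections W S}"

lemma hurwitz_gen_closed:
  assumes "coxeter_system W S" "ts \<in> reflection_tuples W S n" "i \<in> {1..<n}"
  shows "hurwitz_gen W i ts \<in> reflection_tuples W S n"
    and "hurwitz_gen_inv W i ts \<in> reflection_tuples W S n"
proof -
  have "ts ! i \<in> reflections W S" "ts ! (i - 1) \<in> reflections W S"
    using assms(2,3) by (auto simp: reflection_tuples_def subset_iff)
  then show "hurwitz_gen W i ts \<in> reflection_tuples W S n"
    "hurwitz_gen_inv W i ts \<in> reflection_tuples W S n"
    using assms reflections_conj[OF assms(1)]
    unfolding reflection_tuples_def hurwitz_gen_def hurwitz_gen_inv_def
    by (simp_all add: set_update_subsetI)
qed

lemma hurwitz_word_closed: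
  assumes "coxeter_system W S" "ts \<in> reflection_tuples W S n" "u \<in> gwords {1..<n}"
  shows "hurwitz_word W u ts \<in> reflection_tuples W S n"
  using assms(3)
proof (induction u rule: list.induct)
  case (Cons a u)
  obtain i e where "a = (i, e)" by fastforce
  then show ?case using Cons hurwitz_gen_closed[OF assms(1)] by (cases e) auto
qed (use assms in simp)

lemma hurwitz_gen_inverse:
  assumes "coxeter_system W S" "ts \<in> reflection_tuples W S n" "i \<in> {1..<n}"
  shows "hurwitz_gen W i (hurwitz_gen_inv W i ts) = ts"
    and "hurwitz_gen_inv W i (hurwitz_gen W i ts) = ts"
proof -
  interpret group W using assms(1) by (simp add: coxeter_system_def)
  obtain j where i: "i = Suc j" using assms(3) by (cases i) auto
  have r: "ts ! i \<in> reflections W S" "ts ! j \<in> reflections W S"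
    using assms(2,3) i by (auto simp: reflection_tuples_def subset_iff)
  note c = r[THEN reflections_carrier[OF assms(1)]]
  have q: "x \<in> carrier W \<Longrightarrow> ts ! i \<otimes>\<^bsub>W\<^esub> (ts ! i \<otimes>\<^bsub>W\<^esub> x) = x"
    "x \<in> carrier W \<Longrightarrow> ts ! j \<otimes>\<^bsub>W\<^esub> (ts ! j \<otimes>\<^bsub>W\<^esub> x) = x" for x
    using reflections_square[OF assms(1) r(1)] reflections_square[OF assms(1) r(2)] c
    by (simp_all flip: m_assoc)
  note sq = r[THEN reflections_square[OF assms(1)]]
  have len: "length ts = n" "Suc j < n" using assms i by (auto simp: reflection_tuples_def)
  show "hurwitz_gen W i (hurwitz_gen_inv W i ts) = ts"
    "hurwitz_gen_inv W i (hurwitz_gen W i ts) = ts"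
    using c q sq len i
    by (auto intro!: nth_equalityI simp: hurwitz_gen_def hurwitz_gen_inv_def nth_list_update m_assoc)
qed

lemma hurwitz_braid_relations:
  assumes "coxeter_system W S" "ts \<in> reflection_tuples W S n" "(l, r) \<in> braid_relations n"
  shows "hurwitz_word W l ts = hurwitz_word W r ts"
proof -
  interpret group W using assms(1) by (simp add: coxeter_system_def)
  have len: "length ts = n" using assms(2) by (simp add: reflection_tuples_def)
  have refl: "ts ! i \<in> reflections W S" if "i < n" for i
    using assms(2) that by (auto simp: reflection_tuples_def subset_iff)
  note c = refl[THEN reflections_carrier[OF assms(1)]]
  have sq: "ts ! i \<otimes>\<^bsub>W\<^esub> ts ! i = \<one>\<^bsub>W\<^esub>" if "i < n" for i
    using reflections_square[OF assms(1) refl[OF that]] .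
  have q: "ts ! i \<otimes>\<^bsub>W\<^esub> (ts ! i \<otimes>\<^bsub>W\<^esub> x) = x" if "i < n" "x \<in> carrier W" for i x
    using that sq c by (simp flip: m_assoc)
  from assms(3) consider
    (braid) i where "1 \<le> i" "i + 1 < n" "l = [(i, True), (i + 1, True), (i, True)]"
      "r = [(i + 1, True), (i, True), (i + 1, True)]"
  | (comm) i j where "i \<in> {1..<n}" "j \<in> {1..<n}" "i + 1 < j \<or> j + 1 < i"
      "l = [(i, True), (j, True)]" "r = [(j, True), (i, True)]"
    by (auto simp: braid_relations_def)
  then show ?thesis
  proof cases
    case braid
    obtain j where i: "i = Suc j" using braid(1) by (cases i) auto
    show ?thesis
      using braid len c sq q i
      by (simp add: hurwitz_gen_def m_assoc list_update_swap[of "Suc j" j]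
          list_update_swap[of "Suc (Suc j)" j] list_update_swap[of "Suc (Suc j)" "Suc j"])
  next
    case comm
    obtain a b where ij: "i = Suc a" "j = Suc b" using comm(1,2) by (cases i; cases j) auto
    show ?thesis
      using comm len ij
      by (auto simp: hurwitz_gen_def list_update_swap)
  qed
qed

lemma hurwitz_word_respects:
  assumes "coxeter_system W S" "(u, v) \<in> presentation_rel {1..<n} (braid_relations n)"
    "ts \<in> reflection_tuples W S n"
  shows "hurwitz_word W u ts = hurwitz_word W v ts"
  using assms(2,3)
proof (induction arbitrary: ts rule: presentation_rel.induct)
  case (cancel p q x e)
  then show ?case
    using hurwitz_gen_inverse[OF assms(1) hurwitz_word_closed[OF assms(1)]] by (cases e) simp_all
next
  case (relation p q l r)
  then show ?case
    using hurwitz_braid_relations[OF assms(1) hurwitz_word_closed[OF assms(1)]] by simp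
qed auto

lemma hurwitz_action_eq:
  assumes "coxeter_system W S" "\<sigma> \<in> carrier (braid_group n)" "u \<in> \<sigma>"
    "ts \<in> reflection_tuples W S n"
  shows "hurwitz_action W \<sigma> ts = hurwitz_word W u ts"
proof -
  have "(u, v) \<in> presentation_rel {1..<n} (braid_relations n)" if "v \<in> \<sigma>" for v
  proof -
    have "\<sigma> \<in> gwords {1..<n} // presentation_rel {1..<n} (braid_relations n)"
      using assms(2) by (simp add: braid_group_def presented_group_def)
    then show ?thesis
      using quotient_eq_iff[OF equiv_presentation_rel _ _ assms(3) that] by blast
  qed
  then have "hurwitz_word W v ts = hurwitz_word W u ts" if "v \<in> \<sigma>" for v
    using hurwitz_word_respects[OF assms(1) _ assms(4), of u v] that by simp
  then have "\<forall>v\<in>\<sigma>. hurwitz_word W v ts = hurwitz_word W u ts"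
    by (rule ballI)
  moreover have "us = hurwitz_word W u ts" if "\<forall>v\<in>\<sigma>. hurwitz_word W v ts = us" for us
    using bspec[OF that assms(3)] by (rule HOL.sym)
  ultimately show ?thesis
    unfolding hurwitz_action_def by (rule the_equality)
qed

end

theory Submission
  imports Defs Complex_Main "HOL-Library.Function_Algebras" "HOL-Algebra.Multiplicative_Group"
begin

text \<open>
  Call a factorization \<^emph>\<open>repeat-free\<close> if the generators \<open>\<sigma>\<^sub>i\<close> never lead from it to one with two
  equal adjacent factors. The heart of the matter is that a repeat-free factorization \<open>w = t\<^sub>1 \<dots> t\<^sub>n\<close> is never longer
  than any other reflection factorization of \<open>w\<close> (\<open>repeat_free_length_le\<close>). Granted this, a
  factorization with \<open>n > \<ell>\<^sub>T(w)\<close> can be moved to one that contains an adjacent pair \<open>q, q\<close>; such a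
  pair commutes with everything under Hurwitz moves, so it can be pushed to the right end, and the
  remaining \<open>n - 2\<close> factors are treated by induction.

  For the length bound, \<open>W\<close> acts on a Euclidean space so that every \<open>t \<in> T\<close> is the orthogonal
  reflection in a unit vector \<open>\<alpha>\<^sub>t\<close>, and different elements of \<open>T\<close> act differently. The key fact is:

  \<^item> If \<open>t\<^sub>1, \<dots>, t\<^sub>n\<close> is repeat-free and \<open>w = t\<^sub>1 \<dots> t\<^sub>n\<close> fixes \<open>v\<close>, then every \<open>t\<^sub>i\<close> fixes \<open>v\<close>
    (\<open>repeat_free_fixes\<close>).

  To see this, take a vector \<open>\<lambda>\<close> close to \<open>v\<close> and orthogonal to no root, and look at the heights
  \<open>\<langle>\<lambda>, t\<^sub>i\<^sub>+\<^sub>1 \<dots> t\<^sub>n \<lambda>\<rangle>\<close> for \<open>0 \<le> i \<le> n\<close>. Hurwitz moves on the adjacent factors \<open>t\<^sub>i, t\<^sub>i\<^sub>+\<^sub>1\<close> alter only the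
  height between them. As \<open>t\<^sub>i \<noteq> t\<^sub>i\<^sub>+\<^sub>1\<close>, these moves let the point that defines it run through the
  vertices of a regular polygon in the plane of the two roots, and one of them is at least as high as
  the lower of the two neighbouring points, which are vertices of a congruent polygon
  (\<open>dihedral_midpoint\<close>). So among the factorizations that can be reached, one with the largest
  sum of heights has no valley. Its heights are therefore bounded below by the two at the ends, \<open>\<langle>\<lambda>, w \<lambda>\<rangle>\<close> and \<open>\<langle>\<lambda>, \<lambda>\<rangle>\<close>,
  both of which are close to \<open>\<langle>v, v\<rangle>\<close>, the largest value of \<open>\<langle>v, x v\<rangle>\<close>. Since \<open>W\<close> is finite, this
  forces all partial products to fix \<open>v\<close>.

  It follows that the roots of a repeat-free factorization are linearly independent. Otherwise some
  prefix \<open>t\<^sub>1 \<dots> t\<^sub>k\<close> has its last root \<open>\<alpha>\<close> in the span of the roots before, hence orthogonal to the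
  fixed space of \<open>u = t\<^sub>1 \<dots> t\<^sub>k\<^sub>-\<^sub>1\<close>. Then \<open>u\<^sup>-\<^sup>1 x - x = \<alpha>\<close> has a solution \<open>x\<close>. The vectors \<open>x\<close> and
  \<open>u\<^sup>-\<^sup>1 x = x + \<alpha>\<close> have the same length, so \<open>t\<^sub>k\<close> exchanges them, and \<open>u t\<^sub>k\<close> fixes \<open>x\<close> although \<open>t\<^sub>k\<close>
  does not, contrary to the key fact. Finally, if \<open>w = s\<^sub>1 \<dots> s\<^sub>m\<close> with \<open>m < n\<close>, some nonzero
  combination of the \<open>n\<close> roots is orthogonal to the \<open>m\<close> roots of the \<open>s\<^sub>j\<close>; it is fixed by \<open>w\<close>,
  hence by every \<open>t\<^sub>i\<close>, hence orthogonal to itself, which is absurd.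

  The Euclidean space is the geometric representation of the Coxeter system, with an inner product
  obtained by averaging over the finite group. That different elements of \<open>W\<close> act differently is
  Tits' theorem, proved by showing that \<open>g\<close> maps the simple root of \<open>s\<close> to a nonnegative vector
  whenever \<open>gs\<close> is not shorter than \<open>g\<close> (\<open>longer_imp_positive_root\<close>).
\<close>

section \<open>Hurwitz moves and repeated factors\<close>

text \<open>One application of a generator \<open>\<sigma>\<^sub>i\<close>, with the position \<open>i\<close> given by the length of \<open>xs\<close>. Inverse generators are
  left out: rotations of dihedral groups have finite order, and repeated pairs can be pushed to the right by the
  \<open>\<sigma>\<^sub>i\<close> alone.\<close>

inductive hurwitz_move :: "('a, 'b) monoid_scheme \<Rightarrow> 'a list \<Rightarrow> 'a list \<Rightarrow> bool"
  for W :: "('a, 'b) monoid_scheme" where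
  "hurwitz_move W (xs @ a # b # ys) (xs @ (a \<otimes>\<^bsub>W\<^esub> b \<otimes>\<^bsub>W\<^esub> a) # a # ys)"

abbreviation hurwitz_moves :: "('a, 'b) monoid_scheme \<Rightarrow> 'a list \<Rightarrow> 'a list \<Rightarrow> bool" where
  "hurwitz_moves W \<equiv> (hurwitz_move W)\<^sup>*\<^sup>*"

lemma hurwitz_move_append:
  assumes "hurwitz_move W us vs"
  shows "hurwitz_move W (xs @ us @ ys) (xs @ vs @ ys)"
  using assms
proof cases
  case (1 as a b bs)
  then show ?thesis using hurwitz_move.intros[of W "xs @ as" a b "bs @ ys"] by simp
qed

lemma hurwitz_moves_append:
  assumes "hurwitz_moves W us vs"
  shows "hurwitz_moves W (xs @ us @ ys) (xs @ vs @ ys)"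
  using assms
  by (induction rule: rtranclp_induct) (auto intro: rtranclp.rtrancl_into_rtrancl hurwitz_move_append)

lemma hurwitz_moves_length: "hurwitz_moves W us vs \<Longrightarrow> length vs = length us"
  by (induction rule: rtranclp_induct) (auto elim!: hurwitz_move.cases)

definition repeat_free :: "('a, 'b) monoid_scheme \<Rightarrow> 'a list \<Rightarrow> bool" where
  "repeat_free W ts \<longleftrightarrow> (\<nexists>xs q ys. hurwitz_moves W ts (xs @ q # q # ys))"

lemma repeat_free_prefix:
  assumes "repeat_free W (ts @ us)"
  shows "repeat_free W ts"
  unfolding repeat_free_def
proof
  assume "\<exists>xs q ys. hurwitz_moves W ts (xs @ q # q # ys)"
  then obtain xs q ys where "hurwitz_moves W ts (xs @ q # q # ys)" by blast
  from hurwitz_moves_append[OF this, of "[]" us]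
  have "hurwitz_moves W (ts @ us) (xs @ q # q # (ys @ us))" by simp
  with assms show False unfolding repeat_free_def by blast
qed

lemma list_product_simps [simp]:
  "list_product W [] = \<one>\<^bsub>W\<^esub>"
  "list_product W (t # ts) = t \<otimes>\<^bsub>W\<^esub> list_product W ts"
  by (simp_all add: list_product_def)

lemma (in monoid) list_product_closed [simp]:
  "set ts \<subseteq> carrier G \<Longrightarrow> list_product G ts \<in> carrier G"
  by (induction ts) auto

lemma (in monoid) list_product_append:
  "set ts \<subseteq> carrier G \<Longrightarrow> set us \<subseteq> carrier G \<Longrightarrow>
    list_product G (ts @ us) = list_product G ts \<otimes> list_product G us"
  by (induction ts) (auto simp: m_assoc)

locale involution_class = group G for G :: "('a, 'b) monoid_scheme" (structure) +
  fixes T :: "'a set"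
  assumes T_carrier: "T \<subseteq> carrier G"
    and T_square: "t \<in> T \<Longrightarrow> t \<otimes> t = \<one>"
    and T_conj: "t \<in> T \<Longrightarrow> r \<in> T \<Longrightarrow> t \<otimes> r \<otimes> t \<in> T"
begin

lemma T_closed [simp]: "t \<in> T \<Longrightarrow> t \<in> carrier G"
  using T_carrier by blast

lemma T_cancel [simp]: "t \<in> T \<Longrightarrow> x \<in> carrier G \<Longrightarrow> t \<otimes> (t \<otimes> x) = x"
  using T_square[of t] by (simp flip: m_assoc)

lemma T_inv [simp]: "t \<in> T \<Longrightarrow> inv t = t"
  using T_square[of t] inv_equality by simp

lemma T_subset_carrier: "set ts \<subseteq> T \<Longrightarrow> set ts \<subseteq> carrier G"
  using T_carrier by blast

lemma hurwitz_move_closed: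
  assumes "hurwitz_move G us vs" "set us \<subseteq> T"
  shows "set vs \<subseteq> T" "list_product G vs = list_product G us"
  using assms
proof (atomize(full), cases)
  case (1 xs a b ys)
  then have T: "set xs \<subseteq> T" "a \<in> T" "b \<in> T" "set ys \<subseteq> T" using assms(2) by auto
  then have "set ys \<subseteq> carrier G" "set xs \<subseteq> carrier G" by (auto intro: T_subset_carrier)
  then show "set vs \<subseteq> T \<and> list_product G vs = list_product G us"
    using T T_conj[of a b] unfolding 1 by (auto simp: list_product_append m_assoc)
qed

lemma hurwitz_moves_closed:
  assumes "hurwitz_moves G us vs" "set us \<subseteq> T"
  shows "set vs \<subseteq> T" "list_product G vs = list_product G us"
proof -
  have "set vs \<subseteq> T \<and> list_product G vs = list_product G us"
    using assms by (induction rule: rtranclp_induct) (auto dest: hurwitz_move_closed)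
  then show "set vs \<subseteq> T" "list_product G vs = list_product G us" by auto
qed

text \<open>Two moves carry the pair past a factor \<open>r\<close> and leave all three letters unchanged:
  \<open>(q, q, r) \<mapsto> (q, qrq, q) \<mapsto> (r, q, q)\<close>.\<close>

lemma repeated_pair_moves_right:
  assumes "q \<in> T" "set ys \<subseteq> T"
  shows "hurwitz_moves G (q # q # ys) (ys @ [q, q])"
  using assms(2)
proof (induction ys)
  case (Cons r ys)
  then have r: "r \<in> T" by simp
  have qrq: "q \<otimes> (q \<otimes> r \<otimes> q) \<otimes> q = r" using assms(1) r T_square[of q] by (simp add: m_assoc)
  have "hurwitz_moves G (q # q # r # ys) (q # (q \<otimes> r \<otimes> q) # q # ys)"
    using hurwitz_move.intros[of G "[q]" q r ys] by auto
  also have "hurwitz_moves G \<dots> (r # q # q # ys)"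
    using hurwitz_move.intros[of G "[]" q "q \<otimes> r \<otimes> q" "q # ys"] qrq by auto
  also have "hurwitz_moves G \<dots> (r # ys @ [q, q])"
    using hurwitz_moves_append[OF Cons.IH, of "[r]" "[]"] Cons.prems by simp
  finally show ?case by simp
qed simp

text \<open>The combinatorial half of the argument: it reduces the theorem to a bound on the length of
  repeat-free factorizations. The braid that treats the remaining factors only touches a prefix, so the
  pairs already moved to the end stay there.\<close>

lemma repeats_collect_right:
  assumes bound: "\<And>us. set us \<subseteq> T \<Longrightarrow> repeat_free G us \<Longrightarrow>
      list_product G us = w \<Longrightarrow> length us \<le> m"
    and ts: "set ts \<subseteq> T" "list_product G ts = w" "length ts = m + 2 * k"
  shows "\<exists>rs qs. length rs = m \<and> set rs \<subseteq> T \<and> length qs = k \<and> set qs \<subseteq> T \<and>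
    hurwitz_moves G ts (rs @ concat (map (\<lambda>q. [q, q]) qs))"
  using ts
proof (induction k arbitrary: ts)
  case 0
  then show ?case by (intro exI[of _ ts] exI[of _ "[]"]) auto
next
  case (Suc k)
  have "\<not> repeat_free G ts" using bound[of ts] Suc.prems by auto
  then obtain xs q ys where step: "hurwitz_moves G ts (xs @ q # q # ys)"
    unfolding repeat_free_def by blast
  have T: "set xs \<subseteq> T" "q \<in> T" "set ys \<subseteq> T"
    and w: "list_product G (xs @ q # q # ys) = w"
    using hurwitz_moves_closed[OF step] Suc.prems by auto
  have "list_product G (xs @ ys) = w"
    using w T T_subset_carrier by (simp add: list_product_append)
  moreover have "length (xs @ ys) = m + 2 * k"
    using hurwitz_moves_length[OF step] Suc.prems(3) by simp
  ultimately obtain rs qs where rq: "length rs = m" "set rs \<subseteq> T" "length qs = k" "set qs \<subseteq> T"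
    and mv: "hurwitz_moves G (xs @ ys) (rs @ concat (map (\<lambda>q. [q, q]) qs))"
    using Suc.IH[of "xs @ ys"] T by auto
  have "hurwitz_moves G (xs @ q # q # ys) (xs @ ys @ [q, q])"
    using hurwitz_moves_append[OF repeated_pair_moves_right[OF T(2,3)], of xs "[]"] by simp
  also have "hurwitz_moves G \<dots> (rs @ concat (map (\<lambda>q. [q, q]) (qs @ [q])))"
    using hurwitz_moves_append[OF mv, of "[]" "[q, q]"] by simp
  finally have "hurwitz_moves G ts (rs @ concat (map (\<lambda>q. [q, q]) (qs @ [q])))"
    using step by simp
  then show ?case using rq T by (intro exI[of _ rs] exI[of _ "qs @ [q]"]) simp
qed

end

text \<open>The head of a word acts last, so each further move becomes the new head.\<close>

lemma hurwitz_moves_word: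
  assumes "hurwitz_moves W ts us"
  shows "\<exists>u\<in>gwords {1..<length ts}. hurwitz_word W u ts = us"
  using assms
proof (induction rule: rtranclp_induct)
  case base
  show ?case by (rule bexI[of _ "[]"]) auto
next
  case (step us vs)
  then obtain u where u: "u \<in> gwords {1..<length ts}" "hurwitz_word W u ts = us" by blast
  from step(2) obtain xs a b ys where us: "us = xs @ a # b # ys"
    and vs: "vs = xs @ (a \<otimes>\<^bsub>W\<^esub> b \<otimes>\<^bsub>W\<^esub> a) # a # ys"
    by (auto elim: hurwitz_move.cases)
  have len: "length us = length ts" using step(1) by (rule hurwitz_moves_length)
  have "hurwitz_gen W (Suc (length xs)) us = vs"
    unfolding us vs hurwitz_gen_def by (simp add: nth_append list_update_append)
  then show ?case
    using u len us by (intro bexI[of _ "(Suc (length xs), True) # u"]) auto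
qed

lemma hurwitz_moves_action:
  assumes W: "coxeter_system W S" and ts: "set ts \<subseteq> reflections W S" "length ts = n"
    and moves: "hurwitz_moves W ts us"
  shows "\<exists>\<sigma>\<in>carrier (braid_group n). hurwitz_action W \<sigma> ts = us"
proof -
  obtain u where u: "u \<in> gwords {1..<n}" "hurwitz_word W u ts = us"
    using hurwitz_moves_word[OF moves] ts(2) by auto
  let ?\<sigma> = "presentation_class {1..<n} (braid_relations n) u"
  have \<sigma>: "?\<sigma> \<in> carrier (braid_group n)"
    using u(1) by (simp add: braid_group_def presented_group_def quotientI)
  moreover have "hurwitz_action W ?\<sigma> ts = us"
    using hurwitz_action_eq[OF W \<sigma>, of u ts] u ts
    by (auto simp: reflection_tuples_def intro: presentation_rel.refl)
  ultimately show ?thesis by blast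
qed

section \<open>Regular polygons\<close>

text \<open>If \<open>p\<close> is the exact order of \<open>\<zeta>\<close>, its \<open>p\<close> powers are distinct roots of \<open>z\<^sup>p = 1\<close>, and there are only
  \<open>p\<close> of these. Thus an orbit under multiplication by \<open>\<zeta>\<close> consists of all vertices of a regular \<open>p\<close>-gon.\<close>

lemma powers_exhaust_roots_of_unity:
  fixes \<zeta> :: complex
  assumes "\<zeta> ^ N = 1" "N > 0"
  obtains p where "p > 0" "\<zeta> ^ p = 1" "\<And>z. z ^ p = 1 \<Longrightarrow> \<exists>j. z = \<zeta> ^ j"
proof -
  define p where "p = (LEAST p. 0 < p \<and> \<zeta> ^ p = 1)"
  have p: "0 < p \<and> \<zeta> ^ p = 1" unfolding p_def by (rule LeastI[of _ N]) (use assms in auto)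
  have least: "\<not> (0 < q \<and> \<zeta> ^ q = 1)" if "q < p" for q
    using not_less_Least that unfolding p_def by blast
  have nz: "\<zeta> \<noteq> 0" using p by (auto simp: power_0_left)
  have neq: "\<zeta> ^ i \<noteq> \<zeta> ^ j" if "i < j" "j < p" for i j
  proof
    assume "\<zeta> ^ i = \<zeta> ^ j"
    moreover have "\<zeta> ^ j = \<zeta> ^ i * \<zeta> ^ (j - i)" using that by (simp flip: power_add)
    ultimately have "\<zeta> ^ (j - i) = 1" using nz by simp
    moreover have "0 < j - i" "j - i < p" using that by linarith+
    ultimately show False using least[of "j - i"] by blast
  qed
  have "inj_on (\<lambda>j. \<zeta> ^ j) {..<p}"
    by (rule inj_onI) (metis lessThan_iff linorder_neqE_nat neq)
  then have "card ((\<lambda>j. \<zeta> ^ j) ` {..<p}) = p" by (simp add: card_image)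
  moreover have "card {z::complex. z ^ p = 1} = p" using p by (intro card_roots_unity_eq) simp
  moreover have "(\<lambda>j. \<zeta> ^ j) ` {..<p} \<subseteq> {z. z ^ p = 1}"
  proof safe
    fix j
    have "(\<zeta> ^ j) ^ p = (\<zeta> ^ p) ^ j" by (simp add: mult.commute flip: power_mult)
    then show "(\<zeta> ^ j) ^ p = 1" using p by simp
  qed
  ultimately have "(\<lambda>j. \<zeta> ^ j) ` {..<p} = {z. z ^ p = 1}"
    using p by (intro card_subset_eq finite_roots_unity) auto
  then have "\<exists>j. z = \<zeta> ^ j" if "z ^ p = 1" for z using that by (auto simp: set_eq_iff)
  then show ?thesis using that p by blast
qed

text \<open>Consecutive vertices of a regular \<open>p\<close>-gon are an angle \<open>2\<pi>/p\<close> apart, so of two distinct vertices at most one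
  is strictly within \<open>\<pi>/p\<close> of the real axis direction. The computation bounds the midpoint of the two by
  \<open>|1 + \<zeta>|/2 = |cos (\<pi>k/p)|\<close> instead of comparing angles.\<close>

lemma two_vertices_of_polygon_low:
  fixes \<zeta> a :: complex
  assumes "\<zeta> ^ p = 1" "p > 0" "\<zeta> \<noteq> 1"
  shows "min (Re a) (Re (a * \<zeta>)) \<le> cmod a * cos (pi / p)"
proof -
  have "\<zeta> \<in> {z. z ^ p = 1}" using assms by simp
  then obtain k where k: "k < p" "\<zeta> = cis (2 * pi * real k / real p)"
    using bij_betw_roots_unity[OF assms(2)] unfolding bij_betw_def by force
  have k0: "k \<noteq> 0" using assms(3) k by (intro notI) simp
  define x where "x = pi * real k / real p"
  have x1: "pi / p \<le> x"
    using k0 assms(2) unfolding x_def by (simp add: divide_right_mono)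
  have "pi / p + x = pi * (real k + 1) / p" by (simp add: x_def field_simps add_divide_distrib)
  also have "\<dots> \<le> pi * p / p" using k by (intro divide_right_mono mult_left_mono) auto
  also have "\<dots> = pi" using assms(2) by simp
  finally have x2: "pi / p \<le> pi - x" by simp
  have "0 \<le> pi / p" by simp
  then have x0: "0 \<le> x" "x \<le> pi" "0 \<le> pi / p" using x1 x2 by linarith+
  have "cos x \<le> cos (pi / p)" using x0 x1 by (intro cos_monotone_0_pi_le)
  moreover have "cos (pi - x) \<le> cos (pi / p)"
    by (rule cos_monotone_0_pi_le) (use x0 x2 in linarith)+
  ultimately have cosx: "\<bar>cos x\<bar> \<le> cos (pi / p)" by simp
  have "\<zeta> = cis (2 * x)" by (simp add: k(2) x_def mult.assoc)
  then have "1 + \<zeta> = 2 * of_real (cos x) * cis x"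
    by (intro complex_eqI) (simp_all add: cos_double_cos sin_double power2_eq_square)
  then have "cmod (1 + \<zeta>) = 2 * \<bar>cos x\<bar>" by (simp add: norm_mult)
  then have "cmod (a * (1 + \<zeta>)) \<le> cmod a * (2 * cos (pi / p))"
    using cosx by (simp add: norm_mult mult_left_mono)
  moreover have "Re a + Re (a * \<zeta>) = Re (a * (1 + \<zeta>))" by (simp add: algebra_simps)
  ultimately have "Re a + Re (a * \<zeta>) \<le> cmod a * (2 * cos (pi / p))"
    using complex_Re_le_cmod[of "a * (1 + \<zeta>)"] by linarith
  then show ?thesis by linarith
qed

text \<open>Rounding the argument of \<open>b\<close> to a multiple of \<open>2\<pi>/p\<close> gives a vertex within \<open>\<pi>/p\<close> of the real axis direction.\<close>

lemma some_vertex_of_polygon_high: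
  fixes b :: complex
  assumes "p > 0"
  shows "\<exists>z. z ^ p = 1 \<and> cmod b * cos (pi / p) \<le> Re (b * z)"
proof -
  define y where "y = Arg b * p / (2 * pi)"
  define n where "n = - round y"
  have "\<bar>y + of_int n\<bar> \<le> 1 / 2" using of_int_round_abs_le[of y] by (simp add: n_def abs_minus_commute)
  then have "2 * pi / p * \<bar>y + of_int n\<bar> \<le> 2 * pi / p * (1 / 2)" using assms by (intro mult_left_mono) auto
  moreover have "Arg b + 2 * pi * of_int n / p = 2 * pi / p * (y + of_int n)"
    using assms by (simp add: y_def field_simps)
  ultimately have near: "\<bar>Arg b + 2 * pi * of_int n / p\<bar> \<le> pi / p"
    by (simp add: abs_mult)
  have "cos (pi / p) \<le> cos \<bar>Arg b + 2 * pi * of_int n / p\<bar>"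
    using near assms by (intro cos_monotone_0_pi_le) (auto simp: field_simps)
  then have c: "cos (pi / p) \<le> cos (Arg b + 2 * pi * of_int n / p)" by simp
  have "cis (2 * pi * of_int n / p) ^ p = cis (2 * pi * of_int n)"
    using assms by (simp add: DeMoivre)
  also have "\<dots> = 1" by simp
  finally have root: "cis (2 * pi * of_int n / p) ^ p = 1" .
  have "b = of_real (cmod b) * cis (Arg b)" using rcis_cmod_Arg[of b] by (simp add: rcis_def)
  then have "b * cis (2 * pi * of_int n / p) = of_real (cmod b) * cis (Arg b + 2 * pi * of_int n / p)"
    by (metis cis_mult mult.assoc)
  then have "Re (b * cis (2 * pi * of_int n / p)) = cmod b * cos (Arg b + 2 * pi * of_int n / p)"
    by simp
  moreover have "cmod b * cos (pi / p) \<le> cmod b * cos (Arg b + 2 * pi * of_int n / p)"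
    using c by (intro mult_left_mono) auto
  ultimately show ?thesis using root by metis
qed

text \<open>The planar fact behind the removal of valleys: the radius times \<open>cos (\<pi>/p)\<close> separates the lower of two distinct vertices of one
  regular \<open>p\<close>-gon from the highest vertex of any other one with the same centre and radius, whatever the
  angle between the two polygons.\<close>

lemma polygon_vertex_beats_two_others:
  fixes \<zeta> a b :: complex
  assumes "\<zeta> ^ N = 1" "N > 0" "\<zeta> \<noteq> 1" "cmod a = cmod b"
  shows "\<exists>j. min (Re a) (Re (a * \<zeta>)) \<le> Re (b * \<zeta> ^ j)"
proof -
  obtain p where p: "p > 0" "\<zeta> ^ p = 1" "\<And>z. z ^ p = 1 \<Longrightarrow> \<exists>j. z = \<zeta> ^ j"
    using powers_exhaust_roots_of_unity[OF assms(1,2)] by blast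
  obtain z where "z ^ p = 1" "cmod b * cos (pi / p) \<le> Re (b * z)"
    using some_vertex_of_polygon_high[OF p(1)] by blast
  moreover obtain j where "z = \<zeta> ^ j" using p(3) calculation(1) by blast
  ultimately show ?thesis
    using two_vertices_of_polygon_low[OF p(2,1) assms(3), of a] assms(4) by (intro exI[of _ j]) auto
qed

section \<open>Groups generated by Euclidean reflections\<close>

text \<open>The representation space is a subspace \<open>V\<close> of the vector type rather than the whole type, since its dimension
  depends on the group. The form may be degenerate outside \<open>V\<close>.\<close>

locale euclidean_reflections = involution_class G T
  for G :: "('a, 'b) monoid_scheme" (structure) and T :: "'a set" +
  fixes V :: "'v::real_vector set" and ip :: "'v \<Rightarrow> 'v \<Rightarrow> real"
    and act :: "'a \<Rightarrow> 'v \<Rightarrow> 'v" and root :: "'a \<Rightarrow> 'v"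
  assumes finite_carrier: "finite (carrier G)"
    and V_subspace: "subspace V"
    and ip_sym: "ip x y = ip y x"
    and ip_add: "ip (x + y) z = ip x z + ip y z"
    and ip_scale: "ip (c *\<^sub>R x) z = c * ip x z"
    and ip_nonneg: "0 \<le> ip x x"
    and ip_definite: "x \<in> V \<Longrightarrow> ip x x = 0 \<Longrightarrow> x = 0"
    and act_linear: "g \<in> carrier G \<Longrightarrow> linear (act g)"
    and act_one [simp]: "act \<one> x = x"
    and act_mult: "g \<in> carrier G \<Longrightarrow> h \<in> carrier G \<Longrightarrow> act (g \<otimes> h) x = act g (act h x)"
    and act_V: "g \<in> carrier G \<Longrightarrow> x \<in> V \<Longrightarrow> act g x \<in> V"
    and act_isometry: "g \<in> carrier G \<Longrightarrow> ip (act g x) (act g y) = ip x y"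
    and root_V: "t \<in> T \<Longrightarrow> root t \<in> V"
    and root_unit: "t \<in> T \<Longrightarrow> ip (root t) (root t) = 1"
    and act_reflection: "t \<in> T \<Longrightarrow> act t x = x - (2 * ip (root t) x) *\<^sub>R root t"
    and act_inj: "t \<in> T \<Longrightarrow> r \<in> T \<Longrightarrow> (\<And>x. x \<in> V \<Longrightarrow> act t x = act r x) \<Longrightarrow> t = r"
begin

lemma ip_add2: "ip z (x + y) = ip z x + ip z y"
  by (metis ip_sym ip_add)

lemma ip_scale2: "ip z (c *\<^sub>R x) = c * ip z x"
  by (metis ip_sym ip_scale)

lemma ip_zero: "ip 0 x = 0" "ip x 0 = 0"
  using ip_scale[of 0 0 x] ip_scale2[of x 0 0] by simp_all

lemma ip_minus: "ip (- x) y = - ip x y" "ip x (- y) = - ip x y"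
  using ip_scale[of "-1" x y] ip_scale2[of x "-1" y] by simp_all

lemma ip_diff: "ip (x - y) z = ip x z - ip y z" "ip z (x - y) = ip z x - ip z y"
  using ip_add[of x "- y" z] ip_add2[of z x "- y"] by (simp_all add: ip_minus)

lemma ip_sum: "ip (\<Sum>i\<in>A. f i) z = (\<Sum>i\<in>A. ip (f i) z)"
  by (induction A rule: infinite_finite_induct) (auto simp: ip_zero ip_add)

lemma ip_sum2: "ip z (\<Sum>i\<in>A. f i) = (\<Sum>i\<in>A. ip z (f i))"
  by (induction A rule: infinite_finite_induct) (auto simp: ip_zero ip_add2)

lemmas ip_simps = ip_add ip_add2 ip_scale ip_scale2 ip_zero ip_minus ip_diff ip_sum ip_sum2

lemma act_adjoint:
  assumes "g \<in> carrier G"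
  shows "ip x (act g y) = ip (act (inv g) x) y"
proof -
  have "ip x (act g y) = ip (act g (act (inv g) x)) (act g y)"
    using assms by (simp flip: act_mult)
  then show ?thesis using act_isometry assms by simp
qed

lemma act_inv_cancel: "g \<in> carrier G \<Longrightarrow> act (inv g) (act g x) = x"
    "g \<in> carrier G \<Longrightarrow> act g (act (inv g) x) = x"
  by (simp_all flip: act_mult)

lemma root_nonzero: "t \<in> T \<Longrightarrow> root t \<noteq> 0"
  using root_unit[of t] by (auto simp: ip_zero)

lemma fixed_iff: "t \<in> T \<Longrightarrow> act t v = v \<longleftrightarrow> ip (root t) v = 0"
  using root_nonzero by (auto simp: act_reflection)

lemma list_product_fixes:
  assumes "set ts \<subseteq> T" "\<forall>t\<in>set ts. act t v = v"
  shows "act (list_product G ts) v = v"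
  using assms by (induction ts) (auto simp: act_mult T_subset_carrier)

lemma ip_act_reflection: "t \<in> T \<Longrightarrow> ip c (act t x) = ip c x - 2 * ip (root t) x * ip c (root t)"
  by (simp add: act_reflection ip_simps)

text \<open>Completes \<open>root t\<close> to an orthonormal basis of the plane spanned by two roots. The roots of different reflections
  are independent because reflections are determined by how they act on \<open>V\<close>.\<close>

lemma plane_basis:
  assumes "t \<in> T" "t' \<in> T" "t \<noteq> t'"
  obtains e p q where "ip e e = 1" "ip (root t) e = 0" "q \<noteq> 0" "p\<^sup>2 + q\<^sup>2 = 1"
    "root t' = p *\<^sub>R root t + q *\<^sub>R e"
proof -
  define p where "p = ip (root t) (root t')"
  define b where "b = root t' - p *\<^sub>R root t"
  have b: "ip b b = 1 - p\<^sup>2"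
    using assms root_unit by (simp add: b_def ip_simps ip_sym[of "root t'" "root t"] power2_eq_square
        flip: p_def)
  have b_V: "b \<in> V"
    using assms root_V V_subspace unfolding b_def by (intro subspace_diff subspace_scale) auto
  have "ip b b \<noteq> 0"
  proof
    assume "ip b b = 0"
    then have "root t' = p *\<^sub>R root t" "p * p = 1"
      using ip_definite[OF b_V] b by (auto simp: b_def power2_eq_square)
    then have "act t' x = act t x" for x
      using assms by (simp add: act_reflection ip_simps)
    then show False using act_inj[of t t'] assms by auto
  qed
  then have pos: "ip b b > 0" using ip_nonneg[of b] by simp
  define q where "q = sqrt (ip b b)"
  have q: "q \<noteq> 0" "q * q = ip b b" using pos by (auto simp: q_def)
  show ?thesis
  proof (rule that[of "(1 / q) *\<^sub>R b" q p])
    show "ip ((1 / q) *\<^sub>R b) ((1 / q) *\<^sub>R b) = 1" using q(1) by (simp add: ip_simps flip: q(2))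
    have "ip (root t) b = 0" using assms root_unit by (simp add: b_def ip_simps p_def)
    then show "ip (root t) ((1 / q) *\<^sub>R b) = 0" by (simp add: ip_simps)
    show "q \<noteq> 0" by fact
    show "p\<^sup>2 + q\<^sup>2 = 1" using b q by (simp add: power2_eq_square)
    show "root t' = p *\<^sub>R root t + q *\<^sub>R (1 / q) *\<^sub>R b" using q by (simp add: b_def)
  qed
qed

text \<open>A move \<open>(t, t') \<mapsto> (tt't, t)\<close> multiplies both entries by the rotation \<open>tt'\<close> from the left.\<close>

lemma hurwitz_moves_rotate:
  assumes "t \<in> T" "t' \<in> T"
  shows "\<exists>r. hurwitz_moves G [t, t'] [r, (t \<otimes> t') [^] (j::nat) \<otimes> t']"
proof (induction j)
  case 0
  then show ?case using assms by (intro exI[of _ t]) simp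
next
  case (Suc j)
  define \<rho> where "\<rho> = t \<otimes> t'"
  have \<rho>: "\<rho> \<in> carrier G" using assms by (simp add: \<rho>_def)
  from Suc obtain r where r: "hurwitz_moves G [t, t'] [r, \<rho> [^] j \<otimes> t']" unfolding \<rho>_def by blast
  define r' where "r' = \<rho> [^] j \<otimes> t'"
  from hurwitz_moves_closed[OF r] assms have T: "r \<in> T" "r' \<in> T" and prod: "r \<otimes> r' = \<rho>"
    by (auto simp: r'_def \<rho>_def)
  have "r = \<rho> \<otimes> r'" using T by (simp flip: prod add: m_assoc T_square)
  also have "\<dots> = \<rho> [^] Suc j \<otimes> t'"
    unfolding r'_def using \<rho> assms by (simp flip: m_assoc nat_pow_Suc2)
  finally have "r = \<rho> [^] Suc j \<otimes> t'" .
  moreover have "hurwitz_move G [r, r'] [r \<otimes> r' \<otimes> r, r]"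
    using hurwitz_move.intros[of G "[]" r r' "[]"] by simp
  ultimately show ?case
    using r unfolding r'_def \<rho>_def by (metis rtranclp.rtrancl_into_rtrancl)
qed

text \<open>The points \<open>y\<close> and \<open>tt'y\<close> project to two vertices of a regular polygon (possibly shrunk to a point) in the plane
  spanned by the two roots, and the possible intermediate points to the vertices of a congruent one. In the complex
  coordinate \<open>\<kappa>\<close> of this plane, the rotation \<open>tt'\<close> is multiplication by a root of unity \<open>\<zeta> \<noteq> 1\<close>, while the part
  \<open>D\<close> of the height that comes from the orthogonal complement of the plane never changes.\<close>

lemma dihedral_midpoint:
  assumes t: "t \<in> T" "t' \<in> T" "t \<noteq> t'"
  shows "\<exists>r r'. hurwitz_moves G [t, t'] [r, r'] \<and>
    min (ip c y) (ip c (act (t \<otimes> t') y)) \<le> ip c (act r' y)"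
proof -
  obtain e p q where e: "ip e e = 1" "ip (root t) e = 0" and q: "q \<noteq> 0" "p\<^sup>2 + q\<^sup>2 = 1"
    and t'_root: "root t' = p *\<^sub>R root t + q *\<^sub>R e"
    using plane_basis[OF t] by metis
  define \<kappa> where "\<kappa> x = Complex (ip (root t) x) (ip e x)" for x
  define u where "u = Complex p q"
  define \<zeta> where "\<zeta> = cnj (u * u)"
  define \<rho> where "\<rho> = t \<otimes> t'"
  have G: "t \<in> carrier G" "t' \<in> carrier G" "\<rho> \<in> carrier G" using t by (auto simp: \<rho>_def)
  have e': "ip e (root t) = 0" using e(2) ip_sym by metis
  have \<kappa>t: "\<kappa> (act t x) = - cnj (\<kappa> x)" for x
    using t e e' root_unit[of t] by (simp add: \<kappa>_def ip_act_reflection complex_eq_iff)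
  have pq: "q * q = 1 - p * p" using q(2) by (simp add: power2_eq_square)
  have \<kappa>t': "\<kappa> (act t' x) = - (u * u) * cnj (\<kappa> x)" for x
  proof (rule complex_eqI)
    define X Y where "X = ip (root t) x" and "Y = ip e x"
    have root': "ip (root t') x = p * X + q * Y" "ip (root t) (root t') = p" "ip e (root t') = q"
      using t e e' root_unit[of t] by (simp_all add: t'_root ip_simps X_def Y_def)
    have "X - 2 * (p * X + q * Y) * p = - ((p * p - q * q) * X) - 2 * p * q * Y"
      by (simp add: pq algebra_simps)
    then show "Re (\<kappa> (act t' x)) = Re (- (u * u) * cnj (\<kappa> x))"
      using t by (simp add: \<kappa>_def u_def ip_act_reflection root' flip: X_def Y_def)
    have "Y - 2 * (p * X + q * Y) * q = (1 - 2 * (q * q)) * Y - 2 * p * q * X"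
      by (simp add: algebra_simps)
    also have "1 - 2 * (q * q) = p * p - q * q" by (simp add: pq)
    finally show "Im (\<kappa> (act t' x)) = Im (- (u * u) * cnj (\<kappa> x))"
      using t by (simp add: \<kappa>_def u_def ip_act_reflection root' flip: X_def Y_def)
  qed
  have \<kappa>\<rho>: "\<kappa> (act \<rho> x) = \<zeta> * \<kappa> x" for x
    using G by (simp add: \<rho>_def act_mult \<kappa>t \<kappa>t' \<zeta>_def)
  define D where "D x = ip c x - Re (cnj (\<kappa> c) * \<kappa> x)" for x
  have Dt: "D (act t x) = D x" for x
    using t by (simp add: D_def \<kappa>t ip_act_reflection) (simp add: \<kappa>_def ip_sym)
  have Dt': "D (act t' x) = D x" for x
  proof -
    have 1: "\<kappa> (act t' x) = \<kappa> x - (2 * ip (root t') x) *\<^sub>R u"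
      using t e e' root_unit[of t]
      by (simp add: \<kappa>_def u_def complex_eq_iff ip_act_reflection t'_root ip_simps)
    have 2: "ip c (root t') = Re (cnj (\<kappa> c) * u)"
      by (simp add: t'_root ip_simps \<kappa>_def u_def ip_sym)
    show ?thesis
      unfolding D_def ip_act_reflection[OF t(2)] 1 2 by (simp add: algebra_simps)
  qed
  have pow: "\<kappa> (act (\<rho> [^] j) x) = \<zeta> ^ j * \<kappa> x \<and> D (act (\<rho> [^] j) x) = D x" for j :: nat and x
  proof (induction j arbitrary: x)
    case (Suc j)
    then show ?case using G by (simp add: act_mult \<kappa>\<rho>) (simp add: \<rho>_def act_mult Dt Dt')
  qed simp
  have ipD: "ip c x = D x + Re (cnj (\<kappa> c) * \<kappa> x)" for x by (simp add: D_def)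
  have "\<kappa> (root t) = 1" using t e' root_unit by (simp add: \<kappa>_def complex_eq_iff)
  moreover have "\<rho> [^] order G = \<one>" using G finite_carrier by (intro pow_order_eq_1) auto
  ultimately have \<zeta>1: "\<zeta> ^ order G = 1" using pow[of "order G" "root t"] by simp
  have order: "order G > 0" using finite_carrier by (simp add: order_gt_0_iff_finite)
  have \<zeta>2: "\<zeta> \<noteq> 1"
    using q pq by (auto simp: \<zeta>_def u_def complex_eq_iff)
  have "cmod u = 1" using q by (simp add: u_def cmod_def)
  then have "cmod (\<kappa> (act t' y)) = cmod (\<kappa> y)" by (simp add: \<kappa>t' norm_mult)
  then have "\<exists>j. min (Re (cnj (\<kappa> c) * \<kappa> y)) (Re (cnj (\<kappa> c) * \<kappa> y * \<zeta>))
      \<le> Re (cnj (\<kappa> c) * \<kappa> (act t' y) * \<zeta> ^ j)"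
    by (intro polygon_vertex_beats_two_others[OF \<zeta>1 order \<zeta>2]) (simp add: norm_mult)
  then obtain j where j: "min (Re (cnj (\<kappa> c) * \<kappa> y)) (Re (cnj (\<kappa> c) * \<kappa> y * \<zeta>))
      \<le> Re (cnj (\<kappa> c) * \<kappa> (act t' y) * \<zeta> ^ j)" by blast
  obtain r where r: "hurwitz_moves G [t, t'] [r, \<rho> [^] j \<otimes> t']"
    using hurwitz_moves_rotate[OF t(1,2)] unfolding \<rho>_def by blast
  have "ip c (act (\<rho> [^] j \<otimes> t') y) = D y + Re (cnj (\<kappa> c) * \<kappa> (act t' y) * \<zeta> ^ j)"
    using G pow[of j "act t' y"] unfolding ipD by (simp add: act_mult Dt' mult_ac)
  moreover have "ip c (act (t \<otimes> t') y) = D y + Re (cnj (\<kappa> c) * \<kappa> y * \<zeta>)"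
    using pow[of 1 y] G unfolding ipD \<rho>_def[symmetric] by (simp add: mult_ac)
  ultimately show ?thesis using r j ipD[of y] by (intro exI[of _ r] exI[of _ "\<rho> [^] j \<otimes> t'"]) auto
qed

end

text \<open>At an interior minimum, a neighbour would have to have the same value.\<close>

lemma no_valley_min_at_ends:
  fixes f :: "nat \<Rightarrow> real"
  assumes no_valley: "\<And>i. 0 < i \<Longrightarrow> i < n \<Longrightarrow> min (f (i - 1)) (f (i + 1)) \<le> f i"
    and distinct: "\<And>i. i < n \<Longrightarrow> f i \<noteq> f (Suc i)"
    and "i \<le> n"
  shows "min (f 0) (f n) \<le> f i"
proof -
  obtain j where "j \<in> {..n}" and min: "Min (f ` {..n}) = f j"
    by (rule obtains_MIN[of "{..n}" f]) auto
  then have j: "j \<le> n" "\<And>i. i \<le> n \<Longrightarrow> f j \<le> f i"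
    by (auto simp flip: min intro: Min_le)
  have "j = 0 \<or> j = n"
  proof (rule ccontr)
    assume "\<not> (j = 0 \<or> j = n)"
    then have "0 < j" "j < n" using j(1) by auto
    then have "min (f (j - 1)) (f (j + 1)) \<le> f j" "f j \<le> f (j - 1)" "f j \<le> f (j + 1)"
      "f (j - 1) \<noteq> f j" "f j \<noteq> f (j + 1)"
      using no_valley[of j] j(2)[of "j - 1"] j(2)[of "j + 1"] distinct[of "j - 1"] distinct[of j]
      by auto
    then show False by linarith
  qed
  then show ?thesis using j(2)[OF assms(3)] by auto
qed

context euclidean_reflections
begin

definition height :: "'v \<Rightarrow> 'v \<Rightarrow> 'a list \<Rightarrow> nat \<Rightarrow> real" where
  "height c y us i = ip c (act (list_product G (drop i us)) y)"

lemma finite_T: "finite T"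
  using T_carrier finite_carrier finite_subset by blast

text \<open>The representative is one with the largest sum of heights; replacing a valley by the intermediate point of
  \<open>dihedral_midpoint\<close> would increase that sum. All other heights are unchanged because moves inside a pair
  do not change its product.\<close>

lemma no_valley_representative:
  assumes "set ts \<subseteq> T" "repeat_free G ts"
  shows "\<exists>us. hurwitz_moves G ts us \<and> (\<forall>i. 0 < i \<longrightarrow> i < length us \<longrightarrow>
    min (height c y us (i - 1)) (height c y us (i + 1)) \<le> height c y us i)"
proof -
  define F where "F us = (\<Sum>i\<le>length us. height c y us i)" for us
  define orbit where "orbit = {us. hurwitz_moves G ts us}"
  have "orbit \<subseteq> {us. set us \<subseteq> T \<and> length us = length ts}"
    using hurwitz_moves_closed(1)[OF _ assms(1)] hurwitz_moves_length by (fastforce simp: orbit_def)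
  then have "finite orbit" using finite_lists_length_eq[OF finite_T] finite_subset by blast
  moreover have "ts \<in> orbit" by (simp add: orbit_def)
  ultimately obtain us where us: "hurwitz_moves G ts us"
    and maximal: "\<And>vs. hurwitz_moves G ts vs \<Longrightarrow> F vs \<le> F us"
    using obtains_MAX[of orbit F]
    by (metis (mono_tags, lifting) Max_ge empty_iff finite_imageI image_eqI mem_Collect_eq orbit_def)
  have T: "set us \<subseteq> T" using hurwitz_moves_closed[OF us assms(1)] by simp
  have "min (height c y us (i - 1)) (height c y us (i + 1)) \<le> height c y us i"
    if i: "0 < i" "i < length us" for i
  proof -
    define xs ys a b where "xs = take (i - 1) us" and "ys = drop (i + 1) us"
      and "a = us ! (i - 1)" and "b = us ! i"
    have us_eq: "us = xs @ a # b # ys"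
      using i unfolding xs_def ys_def a_def b_def
      by (metis Cons_nth_drop_Suc Suc_eq_plus1 Suc_pred' append_take_drop_id less_imp_diff_less)
    have len: "length xs = i - 1" using i by (simp add: xs_def)
    have ab: "a \<in> T" "b \<in> T" "set xs \<subseteq> T" "set ys \<subseteq> T" using T us_eq by auto
    note carrier = ab(3,4)[THEN T_subset_carrier]
    have "a \<noteq> b" using assms(2) us unfolding repeat_free_def us_eq by blast
    then obtain r r' where rr': "hurwitz_moves G [a, b] [r, r']"
      and mid: "min (ip c (act (list_product G ys) y)) (ip c (act (a \<otimes> b) (act (list_product G ys) y)))
        \<le> ip c (act r' (act (list_product G ys) y))"
      using dihedral_midpoint ab(1,2) by meson
    define vs where "vs = xs @ r # r' # ys"
    from hurwitz_moves_closed[OF rr'] ab have r: "r \<in> T" "r' \<in> T" "r \<otimes> r' = a \<otimes> b" by auto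
    have tail: "r \<otimes> (r' \<otimes> z) = a \<otimes> (b \<otimes> z)" if "z \<in> carrier G" for z
      using r ab that by (simp flip: m_assoc)
    have vs: "hurwitz_moves G ts vs"
      using us hurwitz_moves_append[OF rr', of xs ys] unfolding us_eq vs_def by simp
    have same: "height c y vs j = height c y us j" if "j \<noteq> i" for j
    proof (cases "j < i")
      case True
      then have "j \<le> length xs" using len by linarith
      moreover have "set (drop j xs) \<subseteq> carrier G" using carrier(1) by (meson order_trans set_drop_subset)
      ultimately show ?thesis
        using carrier ab r tail by (simp add: height_def us_eq vs_def list_product_append)
    next
      case False
      then have "j = length xs + 2 + (j - i - 1)" using that i len by linarith
      then have "drop j us = drop (j - i - 1) ys" "drop j vs = drop (j - i - 1) ys"
        unfolding us_eq vs_def by (metis append_Cons append_Nil append_eq_conv_conj drop_drop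
            add.commute drop_Cons_numeral drop0 drop_Suc_Cons numeral_2_eq_2 append_assoc)+
      then show ?thesis by (simp add: height_def)
    qed
    have "length vs = length us" by (simp add: us_eq vs_def)
    then have "F vs - F us = (\<Sum>j\<le>length us. height c y vs j - height c y us j)"
      by (simp add: F_def sum_subtractf)
    also have "\<dots> = (\<Sum>j\<in>{i}. height c y vs j - height c y us j)"
      using i same by (intro sum.mono_neutral_right) auto
    finally have "height c y vs i \<le> height c y us i" using maximal[OF vs] by simp
    moreover have "drop (i - 1) us = a # b # ys" "drop (i + 1) us = ys" "drop i vs = r' # ys"
      using len i by (simp_all add: us_eq vs_def)
    ultimately show ?thesis
      using mid carrier ab r by (simp add: height_def act_mult)
  qed
  then show ?thesis using us by blast
qed

text \<open>The group permutes the roots up to sign, so being orthogonal to no root is preserved.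
  Indeed \<open>act r (root t)\<close> is a multiple of \<open>root (rtr)\<close>, because \<open>rtr\<close> negates it.\<close>

lemma generic_act:
  assumes generic: "\<And>s. s \<in> T \<Longrightarrow> ip (root s) z \<noteq> 0" and "t \<in> T" "r \<in> T"
  shows "ip (root t) (act r z) \<noteq> 0"
proof -
  define s where "s = r \<otimes> t \<otimes> r"
  have s: "s \<in> T" using assms T_conj by (simp add: s_def)
  define \<alpha> where "\<alpha> = act r (root t)"
  have unit: "ip \<alpha> \<alpha> = 1" using assms root_unit by (simp add: \<alpha>_def act_isometry)
  have "s \<otimes> r = r \<otimes> t" using assms by (simp add: s_def m_assoc T_square)
  then have "act s \<alpha> = act (r \<otimes> t) (root t)"
    unfolding \<alpha>_def using s assms by (metis T_closed act_mult)
  also have "\<dots> = act r (act t (root t))" using assms by (intro act_mult) simp_all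
  also have "\<dots> = act r (- root t)"
    using assms root_unit by (simp add: act_reflection scaleR_2)
  also have "\<dots> = - \<alpha>" using assms linear_neg[OF act_linear] by (simp add: \<alpha>_def)
  finally have "2 *\<^sub>R \<alpha> = (2 * ip (root s) \<alpha>) *\<^sub>R root s"
    using s by (simp add: act_reflection scaleR_2 algebra_simps)
  then have \<alpha>: "\<alpha> = ip (root s) \<alpha> *\<^sub>R root s" by (metis scaleR_cancel_left scaleR_scaleR zero_neq_numeral)
  then have "ip (root s) \<alpha> \<noteq> 0" using unit by (auto simp: ip_zero)
  moreover have "ip \<alpha> z = ip (root s) \<alpha> * ip (root s) z" using \<alpha> ip_scale by metis
  ultimately have "ip \<alpha> z \<noteq> 0" using generic[OF s] by simp
  then show ?thesis using assms act_adjoint[of r "root t" z] by (simp add: \<alpha>_def)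
qed

lemma generic_list_product:
  assumes "\<And>s. s \<in> T \<Longrightarrow> ip (root s) z \<noteq> 0" "set us \<subseteq> T" "t \<in> T"
  shows "ip (root t) (act (list_product G us) z) \<noteq> 0"
  using assms(2,3)
proof (induction us arbitrary: t)
  case (Cons r us)
  then show ?case
    using generic_act[of "act (list_product G us) z" t r] by (simp add: act_mult T_subset_carrier)
qed (use assms(1) in simp)

lemma tendsto_ip_perturb:
  "((\<lambda>\<epsilon>. ip (a + \<epsilon> *\<^sub>R b) (a' + \<epsilon> *\<^sub>R b')) \<longlongrightarrow> ip a a') (at_right 0)"
proof -
  have "((\<lambda>\<epsilon>. ip a a' + \<epsilon> * (ip a b' + ip b a') + \<epsilon> * \<epsilon> * ip b b')
      \<longlongrightarrow> ip a a' + 0 * (ip a b' + ip b a') + 0 * 0 * ip b b') (at_right 0)"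
    by (intro tendsto_intros)
  then show ?thesis by (simp add: ip_simps algebra_simps)
qed

text \<open>Finitely many hyperplanes are avoided one at a time, by small perturbations in the direction of the next root.\<close>

lemma generic_vector: "\<exists>\<mu>. \<forall>t\<in>T. ip (root t) \<mu> \<noteq> 0"
proof -
  have "\<exists>\<mu>. \<forall>t\<in>A. ip (root t) \<mu> \<noteq> 0" if "finite A" "A \<subseteq> T" for A
    using that
  proof (induction A)
    case (insert t A)
    then obtain \<mu> where \<mu>: "\<forall>s\<in>A. ip (root s) \<mu> \<noteq> 0" by auto
    show ?case
    proof (cases "ip (root t) \<mu> = 0")
      case False
      then show ?thesis using \<mu> by auto
    next
      case True
      have "eventually (\<lambda>\<epsilon>. \<forall>s\<in>A. ip (root s) (\<mu> + \<epsilon> *\<^sub>R root t) \<noteq> 0) (at_right 0)"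
      proof (intro eventually_ball_finite ballI)
        fix s assume "s \<in> A"
        then show "eventually (\<lambda>\<epsilon>. ip (root s) (\<mu> + \<epsilon> *\<^sub>R root t) \<noteq> 0) (at_right 0)"
          using tendsto_imp_eventually_ne[OF tendsto_ip_perturb[of "root s" 0 \<mu> "root t"]] \<mu> by simp
      qed (use insert in simp)
      then have "eventually (\<lambda>\<epsilon>::real. (\<forall>s\<in>A. ip (root s) (\<mu> + \<epsilon> *\<^sub>R root t) \<noteq> 0) \<and> \<epsilon> > 0) (at_right 0)"
        by (rule eventually_conj) (rule eventually_at_right_less)
      then obtain \<epsilon> :: real where "\<forall>s\<in>A. ip (root s) (\<mu> + \<epsilon> *\<^sub>R root t) \<noteq> 0" "\<epsilon> > 0"
        using eventually_happens[of _ "at_right (0::real)"] by force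
      moreover from this have "ip (root t) (\<mu> + \<epsilon> *\<^sub>R root t) \<noteq> 0"
        using True insert.prems root_unit by (simp add: ip_simps)
      ultimately show ?thesis by blast
    qed
  qed simp
  then show ?thesis using finite_T by blast
qed

text \<open>A move replaces two factors by two others that generate the same subgroup.\<close>

lemma fixes_pullback:
  assumes "hurwitz_moves G us vs" "set us \<subseteq> T" "\<forall>t\<in>set vs. act t v = v"
  shows "\<forall>t\<in>set us. act t v = v"
  using assms
proof (induction rule: converse_rtranclp_induct)
  case (step us us')
  from step.hyps(1) obtain xs a b ys where us: "us = xs @ a # b # ys"
    and us': "us' = xs @ (a \<otimes> b \<otimes> a) # a # ys" by (auto elim: hurwitz_move.cases)
  have "\<forall>t\<in>set us'. act t v = v"
    using step hurwitz_move_closed(1)[OF step.hyps(1)] by blast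
  moreover have "a \<in> T" "b \<in> T" using step.prems us by auto
  moreover from this have "a \<otimes> (a \<otimes> b \<otimes> a) \<otimes> a = b" by (simp add: m_assoc T_square)
  then have "act b v = act a (act (a \<otimes> b \<otimes> a) (act a v))"
    using \<open>a \<in> T\<close> \<open>b \<in> T\<close> by (metis T_closed act_mult m_closed)
  ultimately show ?case by (auto simp: us us')
qed simp

text \<open>The point \<open>\<xi> \<epsilon> = v + \<epsilon> \<mu>\<close> is both the starting point and the direction in which heights are measured. For small
  \<open>\<epsilon>\<close> it is orthogonal to no root, so adjacent heights differ, and every group element that moves \<open>v\<close> takes it below
  both ends of the path. The partial products of a representative without valleys stay above the lower end, so they
  fix \<open>v\<close>. The representative depends on \<open>\<epsilon>\<close>, hence the statement is finally carried back to the given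
  factorization.\<close>

theorem repeat_free_fixes:
  assumes ts: "set ts \<subseteq> T" "repeat_free G ts" and v: "v \<in> V" "act (list_product G ts) v = v"
  shows "\<forall>t\<in>set ts. act t v = v"
proof -
  define w where "w = list_product G ts"
  have w: "w \<in> carrier G" using ts(1) by (simp add: w_def T_subset_carrier)
  obtain \<mu> where \<mu>: "\<forall>t\<in>T. ip (root t) \<mu> \<noteq> 0" using generic_vector by blast
  define \<xi> where "\<xi> \<epsilon> = v + \<epsilon> *\<^sub>R \<mu>" for \<epsilon> :: real
  have "eventually (\<lambda>\<epsilon>. \<forall>t\<in>T. ip (root t) (\<xi> \<epsilon>) \<noteq> 0) (at_right 0)"
  proof (intro eventually_ball_finite[OF finite_T] ballI)
    fix t assume t: "t \<in> T"
    show "eventually (\<lambda>\<epsilon>. ip (root t) (\<xi> \<epsilon>) \<noteq> 0) (at_right 0)"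
    proof (cases "ip (root t) v = 0")
      case True
      then show ?thesis
        using \<mu> t by (intro eventually_mono[OF eventually_at_right_less[of 0]]) (simp add: \<xi>_def ip_simps)
    next
      case False
      then show ?thesis
        using tendsto_imp_eventually_ne[OF tendsto_ip_perturb[of "root t" 0 v \<mu>]] by (simp add: \<xi>_def)
    qed
  qed
  moreover have "eventually (\<lambda>\<epsilon>. \<forall>x\<in>{x \<in> carrier G. ip v (act x v) < ip v v}.
      ip (\<xi> \<epsilon>) (act x (\<xi> \<epsilon>)) < min (ip (\<xi> \<epsilon>) (act w (\<xi> \<epsilon>))) (ip (\<xi> \<epsilon>) (\<xi> \<epsilon>))) (at_right 0)"
  proof (intro eventually_ball_finite ballI)
    fix x assume x: "x \<in> {x \<in> carrier G. ip v (act x v) < ip v v}"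
    have act_\<xi>: "act g (\<xi> \<epsilon>) = act g v + \<epsilon> *\<^sub>R act g \<mu>" if "g \<in> carrier G" for g \<epsilon>
      using act_linear[OF that] by (simp add: \<xi>_def linear_add linear_scale)
    have "((\<lambda>\<epsilon>. min (ip (\<xi> \<epsilon>) (act w (\<xi> \<epsilon>))) (ip (\<xi> \<epsilon>) (\<xi> \<epsilon>)) - ip (\<xi> \<epsilon>) (act x (\<xi> \<epsilon>)))
        \<longlongrightarrow> min (ip v (act w v)) (ip v v) - ip v (act x v)) (at_right 0)"
      using x w by (simp only: act_\<xi> mem_Collect_eq) (unfold \<xi>_def, intro tendsto_intros tendsto_ip_perturb)
    moreover have "0 < min (ip v (act w v)) (ip v v) - ip v (act x v)"
      using x v(2) by (simp add: w_def)
    ultimately have "eventually (\<lambda>\<epsilon>. 0 < min (ip (\<xi> \<epsilon>) (act w (\<xi> \<epsilon>))) (ip (\<xi> \<epsilon>) (\<xi> \<epsilon>))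
        - ip (\<xi> \<epsilon>) (act x (\<xi> \<epsilon>))) (at_right 0)"
      by (rule order_tendstoD(1))
    then show "eventually (\<lambda>\<epsilon>. ip (\<xi> \<epsilon>) (act x (\<xi> \<epsilon>))
        < min (ip (\<xi> \<epsilon>) (act w (\<xi> \<epsilon>))) (ip (\<xi> \<epsilon>) (\<xi> \<epsilon>))) (at_right 0)" by simp
  qed (use finite_carrier in simp)
  ultimately obtain \<epsilon> where generic: "\<And>t. t \<in> T \<Longrightarrow> ip (root t) (\<xi> \<epsilon>) \<noteq> 0"
    and low: "\<And>x. x \<in> carrier G \<Longrightarrow> ip v (act x v) < ip v v \<Longrightarrow>
      ip (\<xi> \<epsilon>) (act x (\<xi> \<epsilon>)) < min (ip (\<xi> \<epsilon>) (act w (\<xi> \<epsilon>))) (ip (\<xi> \<epsilon>) (\<xi> \<epsilon>))"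
    using eventually_happens[OF eventually_conj, of _ "at_right (0::real)"] by force
  obtain us where us: "hurwitz_moves G ts us" and no_valley: "\<And>i. 0 < i \<Longrightarrow> i < length us \<Longrightarrow>
    min (height (\<xi> \<epsilon>) (\<xi> \<epsilon>) us (i - 1)) (height (\<xi> \<epsilon>) (\<xi> \<epsilon>) us (i + 1)) \<le> height (\<xi> \<epsilon>) (\<xi> \<epsilon>) us i"
    using no_valley_representative[OF ts] by blast
  have T: "set us \<subseteq> T" "list_product G us = w"
    using hurwitz_moves_closed[OF us ts(1)] by (auto simp: w_def)
  have drop_T: "set (drop i us) \<subseteq> T" for i using T(1) by (meson order_trans set_drop_subset)
  have step: "list_product G (drop i us) = us ! i \<otimes> list_product G (drop (Suc i) us)"
    if "i < length us" for i
    using that by (simp flip: Cons_nth_drop_Suc)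
  have act_step: "act (list_product G (drop i us)) z = act (us ! i) (act (list_product G (drop (Suc i) us)) z)"
    if "i < length us" for i z
    using that T(1) drop_T by (simp add: step act_mult T_subset_carrier subset_iff)
  have "height (\<xi> \<epsilon>) (\<xi> \<epsilon>) us i \<noteq> height (\<xi> \<epsilon>) (\<xi> \<epsilon>) us (Suc i)" if "i < length us" for i
  proof -
    have t: "us ! i \<in> T" using T(1) that by auto
    show ?thesis
      using generic[OF t] generic_list_product[OF generic drop_T t] that t
      by (simp add: height_def act_step ip_act_reflection ip_sym[of "\<xi> \<epsilon>" "root (us ! i)"])
  qed
  from no_valley_min_at_ends[where n = "length us", OF no_valley this]
  have "min (ip (\<xi> \<epsilon>) (act w (\<xi> \<epsilon>))) (ip (\<xi> \<epsilon>) (\<xi> \<epsilon>)) \<le> height (\<xi> \<epsilon>) (\<xi> \<epsilon>) us i"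
    if "i \<le> length us" for i
    using that T(2) by (simp add: height_def)
  then have "ip v v \<le> ip v (act (list_product G (drop i us)) v)" if "i \<le> length us" for i
    using low[of "list_product G (drop i us)"] drop_T[of i] that
    by (fastforce simp: height_def T_subset_carrier)
  moreover have "act x v = v" if "x \<in> carrier G" "ip v v \<le> ip v (act x v)" for x
  proof -
    \<comment> \<open>equality in the Cauchy--Schwarz inequality for two vectors of the same length\<close>
    have "ip (act x v - v) (act x v - v) = 2 * ip v v - 2 * ip v (act x v)"
      using that by (simp add: ip_simps act_isometry ip_sym[of "act x v" v])
    then have "ip (act x v - v) (act x v - v) = 0" using that ip_nonneg[of "act x v - v"] by simp
    moreover have "act x v - v \<in> V" using that v act_V V_subspace by (simp add: subspace_diff)
    ultimately show ?thesis using ip_definite by fastforce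
  qed
  ultimately have fixed: "act (list_product G (drop i us)) v = v" if "i \<le> length us" for i
    using that drop_T by (simp add: T_subset_carrier)
  have "act (us ! i) v = v" if "i < length us" for i
    using act_step[OF that, of v] fixed[of i] fixed[of "Suc i"] that by simp
  then have "\<forall>t\<in>set us. act t v = v" by (metis in_set_conv_nth)
  then show ?thesis using fixes_pullback[OF us ts(1)] by blast
qed

end

section \<open>Length of repeat-free factorizations\<close>

text \<open>Gaussian elimination: one unknown is eliminated by means of the last equation.\<close>

lemma homogeneous_system_nontrivial:
  fixes a :: "nat \<Rightarrow> nat \<Rightarrow> real"
  assumes "m < n"
  shows "\<exists>c. (\<exists>i<n. c i \<noteq> 0) \<and> (\<forall>j<m. (\<Sum>i<n. c i * a i j) = 0)"
  using assms
proof (induction m arbitrary: n a)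
  case 0
  then show ?case by (intro exI[of _ "\<lambda>_. 1"]) auto
next
  case (Suc m)
  then obtain n' where n: "n = Suc n'" and n': "m < n'" by (cases n) auto
  show ?case
  proof (cases "\<forall>i<n. a i m = 0")
    case True
    obtain c where "\<exists>i<n. c i \<noteq> 0" "\<forall>j<m. (\<Sum>i<n. c i * a i j) = 0"
      using Suc.IH[of n a] Suc.prems by auto
    then show ?thesis using True by (intro exI[of _ c]) (auto simp: less_Suc_eq)
  next
    case False
    then obtain k where k: "k < n" "a k m \<noteq> 0" by blast
    \<comment> \<open>the order-preserving enumeration of the unknowns other than the pivot \<open>k\<close>\<close>
    define s where "s i = (if i < k then i else Suc i)" for i
    have s: "bij_betw s {..<n'} ({..<n} - {k})"
      by (rule bij_betw_byWitness[where f' = "\<lambda>i. if i < k then i else i - 1"])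
        (use k n in \<open>auto simp: s_def\<close>)
    obtain d where d: "\<exists>i<n'. d i \<noteq> 0"
      "\<forall>j<m. (\<Sum>i<n'. d i * (a (s i) j - a (s i) m / a k m * a k j)) = 0"
      using Suc.IH[OF n', of "\<lambda>i j. a (s i) j - a (s i) m / a k m * a k j"] by auto
    define e where "e i = d (inv_into {..<n'} s i)" for i
    define c where "c i = (if i = k then - (\<Sum>i<n'. d i * a (s i) m) / a k m else e i)" for i
    have cs: "c (s i) = d i" if "i < n'" for i
    proof -
      have "s i \<noteq> k" by (simp add: s_def)
      then show ?thesis using that s by (simp add: c_def e_def bij_betw_def inv_into_f_f)
    qed
    have sum_c: "(\<Sum>i<n. c i * a i j) = c k * a k j + (\<Sum>i<n'. d i * a (s i) j)" for j
    proof -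
      have "(\<Sum>i<n. c i * a i j) = c k * a k j + (\<Sum>i\<in>{..<n} - {k}. c i * a i j)"
        using k by (intro sum.remove) auto
      also have "(\<Sum>i\<in>{..<n} - {k}. c i * a i j) = (\<Sum>i<n'. c (s i) * a (s i) j)"
        by (rule sum.reindex_bij_betw[OF s, symmetric])
      finally show ?thesis using cs by simp
    qed
    have "(\<Sum>i<n. c i * a i j) = 0" if "j < Suc m" for j
    proof (cases "j = m")
      case True
      then show ?thesis using k unfolding sum_c by (simp add: c_def)
    next
      case False
      then have "0 = (\<Sum>i<n'. d i * a (s i) j - d i * a (s i) m * (a k j / a k m))"
        using d(2) that by (simp add: algebra_simps)
      also have "\<dots> = (\<Sum>i<n'. d i * a (s i) j) - (\<Sum>i<n'. d i * a (s i) m) * (a k j / a k m)"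
        by (simp add: sum_subtractf sum_distrib_right sum_divide_distrib)
      finally show ?thesis unfolding sum_c by (simp add: c_def)
    qed
    moreover obtain i where "i < n'" "d i \<noteq> 0" using d(1) by blast
    then have "s i < n" "c (s i) \<noteq> 0" using s cs by (auto simp: bij_betw_def)
    ultimately show ?thesis by blast
  qed
qed

context euclidean_reflections
begin

text \<open>The image of \<open>g - 1\<close> is the orthogonal complement of the fixed space of \<open>g\<close>. For \<open>g\<close> of finite order a
  preimage can be written down: if the sum of \<open>a\<close> over all powers of \<open>g\<close> vanishes, then the average of the partial
  sums \<open>a + g a + \<dots> + g\<^sup>j\<^sup>-\<^sup>1 a\<close> is displaced by \<open>-a\<close>.\<close>

lemma displacement_image:
  assumes g: "g \<in> carrier G" and a: "a \<in> V"
    and perp: "\<And>v. v \<in> V \<Longrightarrow> act g v = v \<Longrightarrow> ip a v = 0"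
  shows "\<exists>x\<in>V. act g x - x = a"
proof -
  define N where "N = order G"
  have N: "N > 0" "g [^] N = \<one>"
    using finite_carrier g by (simp_all add: N_def order_gt_0_iff_finite pow_order_eq_1)
  define b where "b i = act (g [^] (i::nat)) a" for i
  define P where "P j = (\<Sum>i<j. b i)" for j :: nat
  have b_V: "b i \<in> V" for i using g a act_V by (simp add: b_def)
  have P_V: "P j \<in> V" for j unfolding P_def by (intro subspace_sum V_subspace b_V)
  have gb: "act g (b i) = b (Suc i)" for i
    unfolding b_def by (subst nat_pow_Suc2) (use g in \<open>simp_all add: act_mult\<close>)
  have lin: "linear (act g)" using g by (rule act_linear)
  have gP: "act g (P j) = P (Suc j) - a" for j
    by (simp add: P_def linear_sum[OF lin] gb sum.lessThan_Suc_shift del: sum.lessThan_Suc)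
      (simp add: b_def)
  have "act g (P N) = P N" using gP[of N] N(2) by (simp add: P_def b_def)
  then have PN: "ip a (P N) = 0" and fixed: "act (g [^] (i::nat)) (P N) = P N" for i
    using perp P_V by (simp, induction i) (simp_all add: act_mult g)
  \<comment> \<open>the sum over all powers of \<open>g\<close> is fixed by \<open>g\<close>, hence orthogonal to all its summands\<close>
  have "ip (b i) (P N) = 0" for i
    using act_isometry[of "g [^] i" a "P N"] g PN by (simp add: b_def fixed)
  then have "ip (P N) (P N) = 0" by (simp add: P_def[of N] ip_sum)
  then have PN0: "P N = 0" using ip_definite P_V by blast
  define y where "y = (\<Sum>j<N. P j)"
  have "act g y = (\<Sum>j<N. P (Suc j)) - N *\<^sub>R a"
    by (simp add: y_def linear_sum[OF lin] gP sum_subtractf scaleR_conv_of_real sum_constant_scaleR)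
  also have "(\<Sum>j<N. P (Suc j)) = y + P N"
    using sum.lessThan_Suc_shift[of P N] by (simp add: y_def P_def[of 0])
  finally have gy: "act g y = y - N *\<^sub>R a" using PN0 by simp
  have "act g ((- 1 / N) *\<^sub>R y) - (- 1 / N) *\<^sub>R y = a"
    unfolding linear_scale[OF lin] gy using N(1) by (simp add: algebra_simps)
  moreover have "(- 1 / N) *\<^sub>R y \<in> V"
    unfolding y_def by (intro subspace_scale subspace_sum V_subspace P_V)
  ultimately show ?thesis by blast
qed

text \<open>Linear independence of the roots in dual form: some vector is orthogonal to all roots but the last. Otherwise the
  last root is orthogonal to the fixed space of the product \<open>u\<close> of the other factors, and a solution \<open>x\<close> of
  \<open>u\<^sup>-\<^sup>1 x - x = root t\<close> is fixed by \<open>ut\<close> but not by \<open>t\<close>.\<close>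

lemma repeat_free_last_root_independent:
  assumes "set ts \<subseteq> T" "t \<in> T" "repeat_free G (ts @ [t])"
  shows "\<exists>v\<in>V. (\<forall>s\<in>set ts. ip (root s) v = 0) \<and> ip (root t) v \<noteq> 0"
proof (rule ccontr)
  assume "\<not> ?thesis"
  then have dep: "ip (root t) v = 0" if "v \<in> V" "\<forall>s\<in>set ts. ip (root s) v = 0" for v
    using that by blast
  define u where "u = list_product G ts"
  have u: "u \<in> carrier G" using assms by (simp add: u_def T_subset_carrier)
  have "ip (root t) v = 0" if v: "v \<in> V" "act (inv u) v = v" for v
  proof -
    have "act u v = v" using act_inv_cancel(2)[OF u, of v] v(2) by simp
    then have "\<forall>s\<in>set ts. act s v = v"
      using repeat_free_fixes[OF assms(1) repeat_free_prefix[OF assms(3)] v(1)] by (simp add: u_def)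
    then have "\<forall>s\<in>set ts. ip (root s) v = 0" using assms(1) fixed_iff by blast
    then show ?thesis using dep v(1) by blast
  qed
  then obtain x where x: "x \<in> V" "act (inv u) x - x = root t"
    using displacement_image[of "inv u" "root t"] u root_V[OF assms(2)] by auto
  have ux: "act (inv u) x = x + root t" using x(2) by (simp add: algebra_simps)
  have "ip (x + root t) (x + root t) = ip x x" using act_isometry[of "inv u" x x] u ux by simp
  \<comment> \<open>\<open>x\<close> and \<open>x + root t\<close> have the same length, so the reflection \<open>t\<close> exchanges them\<close>
  then have half: "2 * ip (root t) x = - 1"
    using root_unit[OF assms(2)] by (simp add: ip_simps ip_sym[of x "root t"])
  then have tx: "act t x = x + root t" using assms(2) by (simp add: act_reflection)
  have "act (list_product G (ts @ [t])) x = act u (act t x)"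
    using assms by (simp add: list_product_append T_subset_carrier act_mult u_def)
  also have "\<dots> = x" using ux tx act_inv_cancel(2)[OF u, of x] by simp
  finally have "act t x = x"
    using repeat_free_fixes[of "ts @ [t]" x] assms x(1) by simp
  then show False using tx root_nonzero[OF assms(2)] by simp
qed

text \<open>With more factors than \<open>rs\<close> has, some nontrivial combination \<open>v\<close> of the roots is orthogonal to all roots of \<open>rs\<close>.
  It is then fixed by the product, so by \<open>repeat_free_fixes\<close> it is orthogonal to all roots of \<open>ts\<close> and vanishes;
  the last root that occurs in it contradicts independence.\<close>

theorem repeat_free_length_le:
  assumes ts: "set ts \<subseteq> T" "repeat_free G ts"
    and rs: "set rs \<subseteq> T" "list_product G rs = list_product G ts"
  shows "length ts \<le> length rs"
proof (rule ccontr)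
  define \<alpha> \<beta> where "\<alpha> i = root (ts ! i)" and "\<beta> j = root (rs ! j)" for i j
  assume "\<not> length ts \<le> length rs"
  then obtain c where c: "\<exists>i<length ts. c i \<noteq> 0"
    "\<forall>j<length rs. (\<Sum>i<length ts. c i * ip (\<beta> j) (\<alpha> i)) = 0"
    using homogeneous_system_nontrivial[of "length rs" "length ts" "\<lambda>i j. ip (\<beta> j) (\<alpha> i)"] by auto
  define v where "v = (\<Sum>i<length ts. c i *\<^sub>R \<alpha> i)"
  have v_V: "v \<in> V"
    unfolding v_def \<alpha>_def using ts(1) root_V
    by (intro subspace_sum subspace_scale V_subspace) (auto simp: subset_iff)
  have "ip (root r) v = 0" if "r \<in> set rs" for r
    using that c(2) by (auto simp: v_def ip_simps \<beta>_def in_set_conv_nth)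
  then have "\<forall>r\<in>set rs. act r v = v" using rs(1) fixed_iff by blast
  then have "act (list_product G ts) v = v" using list_product_fixes[OF rs(1)] rs(2) by metis
  then have "\<forall>t\<in>set ts. act t v = v" using repeat_free_fixes[OF ts v_V] by blast
  then have "ip (\<alpha> i) v = 0" if "i < length ts" for i
    using that ts(1) fixed_iff unfolding \<alpha>_def by (metis nth_mem subsetD)
  moreover have ip_v: "ip v z = (\<Sum>i<length ts. c i * ip (\<alpha> i) z)" for z
    by (simp add: v_def ip_sum ip_scale)
  ultimately have "ip v v = 0" by simp
  then have v0: "v = 0" using ip_definite v_V by blast
  define k where "k = Max {i. i < length ts \<and> c i \<noteq> 0}"
  have fin: "finite {i. i < length ts \<and> c i \<noteq> 0}" by simp
  have k: "k < length ts" "c k \<noteq> 0"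
    using Max_in[OF fin] c(1) unfolding k_def by auto
  have later: "c i = 0" if "k < i" "i < length ts" for i
    using Max_ge[OF fin, of i] that unfolding k_def by fastforce
  have "repeat_free G (take k ts @ [ts ! k])"
    using repeat_free_prefix[of G "take (Suc k) ts" "drop (Suc k) ts"] ts(2) k(1)
    by (metis append_take_drop_id take_Suc_conv_app_nth)
  moreover have "set (take k ts) \<subseteq> T" "ts ! k \<in> T"
    using ts(1) k(1) set_take_subset by (fastforce, auto)
  ultimately obtain z where z: "\<forall>s\<in>set (take k ts). ip (root s) z = 0" "ip (\<alpha> k) z \<noteq> 0"
    using repeat_free_last_root_independent unfolding \<alpha>_def by metis
  have "ip (\<alpha> i) z = 0" if "i < k" for i
  proof -
    have "ts ! i \<in> set (take k ts)"
      using that k(1) by (auto simp: in_set_conv_nth intro!: exI[of _ i])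
    then show ?thesis using z(1) by (simp add: \<alpha>_def)
  qed
  then have "c i * ip (\<alpha> i) z = 0" if "i < length ts" "i \<noteq> k" for i
    using that later[of i] by (cases i k rule: linorder_cases) auto
  then have "(\<Sum>i<length ts. c i * ip (\<alpha> i) z) = (\<Sum>i\<in>{k}. c i * ip (\<alpha> i) z)"
    using k(1) by (intro sum.mono_neutral_right) auto
  then have "c k * ip (\<alpha> k) z = 0" using v0 ip_v[of z] by (simp add: ip_zero)
  then show False using k(2) z(2) by simp
qed

end

section \<open>Representations of a Coxeter system\<close>

text \<open>Extracts from the abstract isomorphism an evaluation map \<open>ev\<close> on signed words, for which two words have the same
  value exactly if the relations of the presentation identify them.\<close>

lemma coxeter_system_words:
  assumes "coxeter_system W S"
  obtains M ev where "coxeter_matrix S M"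
    and "\<And>u. u \<in> gwords S \<Longrightarrow> ev u \<in> carrier W"
    and "\<And>w. w \<in> carrier W \<Longrightarrow> \<exists>u\<in>gwords S. ev u = w"
    and "\<And>u v. u \<in> gwords S \<Longrightarrow> v \<in> gwords S \<Longrightarrow> ev (u @ v) = ev u \<otimes>\<^bsub>W\<^esub> ev v"
    and "\<And>s. s \<in> S \<Longrightarrow> ev [(s, True)] = s"
    and "\<And>u v. u \<in> gwords S \<Longrightarrow> v \<in> gwords S \<Longrightarrow>
      ev u = ev v \<longleftrightarrow> (u, v) \<in> presentation_rel S (coxeter_relations S M)"
proof -
  obtain M \<phi> where M: "coxeter_matrix S M"
    and \<phi>: "\<phi> \<in> iso (presented_group S (coxeter_relations S M)) W"
    and \<phi>s: "\<forall>s\<in>S. \<phi> (presentation_class S (coxeter_relations S M) [(s, True)]) = s"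
    using assms unfolding coxeter_system_def by blast
  let ?R = "coxeter_relations S M"
  let ?P = "presented_group S ?R"
  have cls: "presentation_class S ?R u \<in> carrier ?P" if "u \<in> gwords S" for u
    using that by (simp add: presented_group_def quotientI)
  have bij: "bij_betw \<phi> (carrier ?P) (carrier W)"
    and hom: "\<And>A B. A \<in> carrier ?P \<Longrightarrow> B \<in> carrier ?P \<Longrightarrow> \<phi> (A \<otimes>\<^bsub>?P\<^esub> B) = \<phi> A \<otimes>\<^bsub>W\<^esub> \<phi> B"
    using \<phi> by (auto simp: iso_def hom_def)
  define ev where "ev u = \<phi> (presentation_class S ?R u)" for u
  have closed: "ev u \<in> carrier W" if "u \<in> gwords S" for u
    unfolding ev_def by (rule bij_betw_apply[OF bij cls[OF that]])
  have surj: "\<exists>u\<in>gwords S. ev u = w" if "w \<in> carrier W" for w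
  proof -
    have "w \<in> \<phi> ` carrier ?P" using that unfolding bij_betw_imp_surj_on[OF bij] .
    then obtain A where A: "A \<in> carrier ?P" "w = \<phi> A" by (elim imageE)
    from A(1) have "A \<in> gwords S // presentation_rel S ?R" by (simp add: presented_group_def)
    then obtain u where u: "u \<in> gwords S" "A = presentation_class S ?R u" by (rule quotientE)
    show ?thesis by (rule bexI[OF _ u(1)]) (simp only: ev_def A(2) u(2))
  qed
  have append: "ev (u @ v) = ev u \<otimes>\<^bsub>W\<^esub> ev v" if "u \<in> gwords S" "v \<in> gwords S" for u v
    unfolding ev_def hom[OF cls[OF that(1)] cls[OF that(2)], symmetric] presented_group_mult[OF that] ..
  have letter: "ev [(s, True)] = s" if "s \<in> S" for s
    unfolding ev_def using \<phi>s that by (rule bspec)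
  have eq: "ev u = ev v \<longleftrightarrow> (u, v) \<in> presentation_rel S ?R"
    if uv: "u \<in> gwords S" "v \<in> gwords S" for u v
  proof -
    have "ev u = ev v \<longleftrightarrow> presentation_class S ?R u = presentation_class S ?R v"
      unfolding ev_def by (rule inj_on_eq_iff[OF bij_betw_imp_inj_on[OF bij] cls[OF uv(1)] cls[OF uv(2)]])
    also have "\<dots> \<longleftrightarrow> (u, v) \<in> presentation_rel S ?R"
      by (rule eq_equiv_class_iff[OF equiv_presentation_rel uv])
    finally show ?thesis .
  qed
  show ?thesis by (rule that[of M ev, OF M closed surj append letter eq])
qed

locale coxeter_words = group W for W :: "('a, 'b) monoid_scheme" (structure) +
  fixes S :: "'a set" and M :: "'a \<Rightarrow> 'a \<Rightarrow> nat" and ev :: "'a gword \<Rightarrow> 'a"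
  assumes finite_W: "finite (carrier W)"
    and system: "coxeter_system W S"
    and matrix: "coxeter_matrix S M"
    and ev_closed: "u \<in> gwords S \<Longrightarrow> ev u \<in> carrier W"
    and ev_surj: "w \<in> carrier W \<Longrightarrow> \<exists>u\<in>gwords S. ev u = w"
    and ev_append: "u \<in> gwords S \<Longrightarrow> v \<in> gwords S \<Longrightarrow> ev (u @ v) = ev u \<otimes> ev v"
    and ev_letter: "s \<in> S \<Longrightarrow> ev [(s, True)] = s"
    and ev_eq: "u \<in> gwords S \<Longrightarrow> v \<in> gwords S \<Longrightarrow>
      ev u = ev v \<longleftrightarrow> (u, v) \<in> presentation_rel S (coxeter_relations S M)"
begin

lemma S_carrier: "S \<subseteq> carrier W"
  using system by (simp add: coxeter_system_def)

lemma S_closed [simp]: "s \<in> S \<Longrightarrow> s \<in> carrier W"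
  using S_carrier by blast

lemma finite_S: "finite S"
  using S_carrier finite_W finite_subset by blast

lemma S_square: "s \<in> S \<Longrightarrow> s \<otimes> s = \<one>"
  using coxeter_generator_square[OF system] .

lemma S_cancel [simp]: "s \<in> S \<Longrightarrow> x \<in> carrier W \<Longrightarrow> s \<otimes> (s \<otimes> x) = x"
  using S_square[of s] by (simp flip: m_assoc)

lemma S_cancel_right [simp]: "s \<in> S \<Longrightarrow> x \<in> carrier W \<Longrightarrow> x \<otimes> s \<otimes> s = x"
  using S_square[of s] by (simp add: m_assoc)

lemma S_subset_carrier: "set ss \<subseteq> S \<Longrightarrow> set ss \<subseteq> carrier W"
  using S_carrier by blast

lemma ev_Nil: "ev [] = \<one>"
  using ev_append[of "[]" "[]"] ev_closed[of "[]"] by simp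

lemma ev_signed_letter: "s \<in> S \<Longrightarrow> ev [(s, e)] = s"
proof (cases e)
  case False
  assume s: "s \<in> S"
  have "([(s, False), (s, True)], []) \<in> presentation_rel S (coxeter_relations S M)"
    using presentation_rel.cancel[of "[]" S "[]" s False] s by simp
  then have "ev ([(s, False)] @ [(s, True)]) = \<one>" using ev_eq[of _ "[]"] s by (simp add: ev_Nil)
  moreover have "ev ([(s, False)] @ [(s, True)]) = ev [(s, False)] \<otimes> ev [(s, True)]"
    using s by (intro ev_append) simp_all
  ultimately have "ev [(s, False)] \<otimes> s = \<one>" using s by (simp add: ev_letter)
  moreover have "ev [(s, False)] \<in> carrier W" using s by (intro ev_closed) simp
  ultimately show ?thesis using s False S_square[of s] by (metis S_closed right_cancel)
qed (simp add: ev_letter)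

lemma generated_by_S:
  assumes "w \<in> carrier W"
  shows "\<exists>ss. set ss \<subseteq> S \<and> list_product W ss = w"
proof -
  have "list_product W (map fst u) = ev u" if "u \<in> gwords S" for u
    using that
  proof (induction u rule: list.induct)
    case (Cons a u)
    obtain s e where a: "a = (s, e)" by fastforce
    have "ev ([a] @ u) = ev [a] \<otimes> ev u" using Cons.prems by (intro ev_append) auto
    then show ?case using Cons a ev_signed_letter by simp
  qed (simp add: ev_Nil)
  moreover have "set (map fst u) \<subseteq> S" if "u \<in> gwords S" for u
    using that by auto
  ultimately show ?thesis using ev_surj[OF assms] by blast
qed

lemma ev_concat_replicate:
  assumes "s \<in> S" "t \<in> S"
  shows "ev (concat (replicate n [(s, True), (t, True)])) = (s \<otimes> t) [^] n"
proof (induction n)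
  case (Suc n)
  have "ev [(s, True), (t, True)] = s \<otimes> t"
    using ev_append[of "[(s, True)]" "[(t, True)]"] assms by (simp add: ev_letter)
  moreover have "concat (replicate n [(s, True), (t, True)]) \<in> gwords S"
    using assms by (induction n) auto
  ultimately have "ev (concat (replicate (Suc n) [(s, True), (t, True)])) = s \<otimes> t \<otimes> (s \<otimes> t) [^] n"
    using ev_append[of "[(s, True), (t, True)]" "concat (replicate n [(s, True), (t, True)])"] Suc assms
    by simp
  then show ?case using assms by (subst nat_pow_Suc2) simp_all
qed (simp add: ev_Nil)

lemma coxeter_relation:
  assumes "s \<in> S" "t \<in> S"
  shows "(concat (replicate (M s t) [(s, True), (t, True)]), [])
    \<in> presentation_rel S (coxeter_relations S M)"
proof -
  let ?l = "concat (replicate (M s t) [(s, True), (t, True)])"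
  have "?l \<in> gwords S" using assms by (auto split: if_splits)
  moreover have "(?l, []) \<in> coxeter_relations S M"
    using assms by (auto simp: coxeter_relations_def)
  ultimately show ?thesis using presentation_rel.relation[of "[]" S "[]" ?l "[]"] by simp
qed

lemma braid_power:
  assumes "s \<in> S" "t \<in> S"
  shows "(s \<otimes> t) [^] M s t = \<one>"
  using ev_eq[THEN iffD2, OF _ _ coxeter_relation[OF assms]] presentation_rel_words[OF coxeter_relation[OF assms]]
  by (simp add: ev_concat_replicate[OF assms] ev_Nil)

definition word_action :: "('a \<Rightarrow> 'x \<Rightarrow> 'x) \<Rightarrow> 'a gword \<Rightarrow> 'x \<Rightarrow> 'x" where
  "word_action \<sigma> u x = foldr (\<lambda>(s, _). \<sigma> s) u x"

text \<open>The action of \<open>w\<close> is that of an arbitrarily chosen word for \<open>w\<close>. A formal inverse acts like the letter itself, as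
  the generators are to act by involutions.\<close>

definition extended_action :: "('a \<Rightarrow> 'x \<Rightarrow> 'x) \<Rightarrow> 'a \<Rightarrow> 'x \<Rightarrow> 'x" where
  "extended_action \<sigma> w = word_action \<sigma> (SOME u. u \<in> gwords S \<and> ev u = w)"

lemma word_action_append: "word_action \<sigma> (u @ v) x = word_action \<sigma> u (word_action \<sigma> v x)"
  by (simp add: word_action_def)

context
  fixes \<sigma> :: "'a \<Rightarrow> 'x \<Rightarrow> 'x"
  assumes involution: "\<And>s x. s \<in> S \<Longrightarrow> \<sigma> s (\<sigma> s x) = x"
    and power: "\<And>s t x. s \<in> S \<Longrightarrow> t \<in> S \<Longrightarrow> ((\<sigma> s \<circ> \<sigma> t) ^^ M s t) x = x"
begin

text \<open>The universal property of the presentation, for involutions that satisfy the braid relations.\<close>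

lemma word_action_respects:
  "(u, v) \<in> presentation_rel S (coxeter_relations S M) \<Longrightarrow> word_action \<sigma> u x = word_action \<sigma> v x"
proof (induction arbitrary: x rule: presentation_rel.induct)
  case (cancel p q s e)
  then show ?case using involution by (simp add: word_action_def)
next
  case (relation p q l r)
  then obtain s t where st: "s \<in> S" "t \<in> S" "r = []"
    and l: "l = concat (replicate (M s t) [(s, True), (t, True)])"
    by (auto simp: coxeter_relations_def)
  have "word_action \<sigma> (concat (replicate n [(s, True), (t, True)])) x = ((\<sigma> s \<circ> \<sigma> t) ^^ n) x" for n x
    by (induction n) (simp_all add: word_action_def)
  then have "word_action \<sigma> l y = y" for y using power[OF st(1,2)] l by simp
  then show ?case using st(3) by (simp add: word_action_append)
qed auto

lemma extended_action_word:
  assumes "u \<in> gwords S"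
  shows "extended_action \<sigma> (ev u) x = word_action \<sigma> u x"
proof -
  let ?v = "SOME v. v \<in> gwords S \<and> ev v = ev u"
  have "?v \<in> gwords S \<and> ev ?v = ev u" by (rule someI[of _ u]) (use assms in simp)
  then have "(?v, u) \<in> presentation_rel S (coxeter_relations S M)" using ev_eq assms by blast
  then show ?thesis unfolding extended_action_def by (rule word_action_respects)
qed

lemma extended_action_mult:
  assumes "g \<in> carrier W" "h \<in> carrier W"
  shows "extended_action \<sigma> (g \<otimes> h) x = extended_action \<sigma> g (extended_action \<sigma> h x)"
proof -
  obtain u v where uv: "u \<in> gwords S" "v \<in> gwords S" "ev u = g" "ev v = h"
    using ev_surj assms by meson
  then have "u @ v \<in> gwords S" "ev (u @ v) = g \<otimes> h" using ev_append by auto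
  then show ?thesis using extended_action_word uv word_action_append by metis
qed

lemma extended_action_one: "extended_action \<sigma> \<one> x = x"
  using extended_action_word[of "[]" x] by (simp add: ev_Nil word_action_def)

lemma extended_action_generator: "s \<in> S \<Longrightarrow> extended_action \<sigma> s x = \<sigma> s x"
  using extended_action_word[of "[(s, True)]" x] by (simp add: ev_letter word_action_def)

end

end

section \<open>The geometric representation\<close>

instantiation "fun" :: (type, real_vector) real_vector
begin

definition scaleR_fun_def: "c *\<^sub>R f = (\<lambda>x. c *\<^sub>R f x)"

instance
  by standard (auto simp: scaleR_fun_def fun_eq_iff scaleR_add_right scaleR_add_left)

end

lemma scaleR_fun_apply [simp]: "(c *\<^sub>R f) x = c *\<^sub>R f x"
  by (simp add: scaleR_fun_def)

text \<open>The coefficients \<open>U k = sin (k\<theta>) / sin \<theta>\<close> describe the orbit of \<open>a\<close> and \<open>b\<close> under the rotation \<open>RQ\<close> by \<open>2\<theta>\<close>.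
  Since \<open>sin \<theta> \<noteq> 0\<close>, every vector is the sum of one in the plane of \<open>a\<close> and \<open>b\<close> and one fixed by both
  reflections.\<close>

lemma product_of_reflections_order:
  fixes a b :: "'v::real_vector" and f g :: "'v \<Rightarrow> real"
  assumes f: "linear f" "f a = 1" "f b = - cos (pi / m)"
    and g: "linear g" "g b = 1" "g a = - cos (pi / m)"
    and m: "m \<ge> (2::nat)"
  defines "R \<equiv> \<lambda>x. x - (2 * f x) *\<^sub>R a" and "Q \<equiv> \<lambda>x. x - (2 * g x) *\<^sub>R b"
  shows "((R \<circ> Q) ^^ m) x = x"
proof -
  define \<theta> where "\<theta> = pi / m"
  define c where "c = cos \<theta>"
  have "0 < \<theta>" "\<theta> < pi" using m by (auto simp: \<theta>_def field_simps)
  then have sin: "sin \<theta> > 0" by (rule sin_gt_zero)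
  define U where "U k = sin (k * \<theta>) / sin \<theta>" for k :: real
  have U: "U (k + 1) = 2 * c * U k - U (k - 1)" for k
  proof -
    have "sin ((k + 1) * \<theta>) + sin ((k - 1) * \<theta>) = 2 * c * sin (k * \<theta>)"
      by (simp add: c_def distrib_right left_diff_distrib sin_add sin_diff)
    then have "sin ((k + 1) * \<theta>) = 2 * c * sin (k * \<theta>) - sin ((k - 1) * \<theta>)" by simp
    then show ?thesis by (simp add: U_def diff_divide_distrib)
  qed
  have m\<theta>: "m * \<theta> = pi" using m by (simp add: \<theta>_def)
  have rot: "(R \<circ> Q) (p *\<^sub>R a + q *\<^sub>R b)
      = (2 * c * (2 * c * p - q) - p) *\<^sub>R a + (2 * c * p - q) *\<^sub>R b" for p q
    using f g
    by (simp add: R_def Q_def linear_add linear_scale linear_diff c_def \<theta>_def algebra_simps)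
      (simp flip: scaleR_add_left scaleR_diff_left add: algebra_simps)
  have pow: "((R \<circ> Q) ^^ j) (p *\<^sub>R a + q *\<^sub>R b + z)
      = (p * U (2 * real j + 1) - q * U (2 * real j)) *\<^sub>R a + (p * U (2 * real j) - q * U (2 * real j - 1)) *\<^sub>R b + z"
    if z: "f z = 0" "g z = 0" for p q z and j :: nat
  proof (induction j)
    case 0
    then show ?case using sin by (simp add: U_def)
  next
    case (Suc j)
    define p' q' where "p' = p * U (2 * real j + 1) - q * U (2 * real j)" and "q' = p * U (2 * real j) - q * U (2 * real j - 1)"
    have "(R \<circ> Q) (y + z) = (R \<circ> Q) y + z" for y
      using f g z by (simp add: R_def Q_def linear_add linear_scale linear_diff algebra_simps)
    note shift = this
    have "((R \<circ> Q) ^^ Suc j) (p *\<^sub>R a + q *\<^sub>R b + z) = (R \<circ> Q) (p' *\<^sub>R a + q' *\<^sub>R b + z)"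
      unfolding p'_def q'_def by (subst funpow.simps(2), subst o_apply, subst Suc.IH) (rule HOL.refl)
    also have "\<dots> = (2 * c * (2 * c * p' - q') - p') *\<^sub>R a + (2 * c * p' - q') *\<^sub>R b + z"
      by (simp only: shift rot)
    finally have step: "((R \<circ> Q) ^^ Suc j) (p *\<^sub>R a + q *\<^sub>R b + z)
      = (2 * c * (2 * c * p' - q') - p') *\<^sub>R a + (2 * c * p' - q') *\<^sub>R b + z" .
    have U0: "U (2 * real j - 1) = 2 * c * U (2 * real j) - U (2 * real j + 1)"
      using U[of "2 * real j"] by simp
    have U1: "U (2 * real j + 2) = 2 * c * U (2 * real j + 1) - U (2 * real j)"
      using U[of "2 * real j + 1"] by (simp add: add.assoc)
    have U2: "U (2 * real j + 3) = 2 * c * U (2 * real j + 2) - U (2 * real j + 1)"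
    proof -
      have "2 * real j + 2 + 1 = 2 * real j + 3" "2 * real j + 2 - 1 = 2 * real j + 1" by simp_all
      then show ?thesis using U[of "2 * real j + 2"] by metis
    qed
    have b: "2 * c * p' - q' = p * U (2 * real j + 2) - q * U (2 * real j + 1)"
      unfolding p'_def q'_def U1 U0 by (simp add: algebra_simps)
    have a: "2 * c * (2 * c * p' - q') - p' = p * U (2 * real j + 3) - q * U (2 * real j + 2)"
      unfolding b unfolding p'_def U2 U1 by (simp add: algebra_simps)
    show ?case unfolding step a unfolding b by (simp add: algebra_simps)
  qed
  define p q where "p = (f x + c * g x) / (1 - c * c)" and "q = (g x + c * f x) / (1 - c * c)"
  define z where "z = x - p *\<^sub>R a - q *\<^sub>R b"
  have "1 - c * c = sin \<theta> * sin \<theta>"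
    using sin_cos_squared_add3[of \<theta>] unfolding c_def by linarith
  then have cc: "1 - c * c \<noteq> 0" using sin by simp
  have "f z = f x - p + c * q" "g z = g x - q + c * p"
    using f g by (simp_all add: z_def linear_diff linear_scale c_def \<theta>_def)
  moreover have "f x - p + c * q = 0" "g x - q + c * p = 0"
    using cc unfolding p_def q_def by (simp_all add: field_simps)
  ultimately have z: "f z = 0" "g z = 0" by simp_all
  have "2 * (m * \<theta>) = 2 * pi" unfolding m\<theta> ..
  then have "U (2 * real m) = 0" "U (2 * real m + 1) = 1" "U (2 * real m - 1) = - 1"
    using sin by (simp_all add: U_def distrib_right left_diff_distrib sin_add sin_diff mult.assoc)
  then have "((R \<circ> Q) ^^ m) (p *\<^sub>R a + q *\<^sub>R b + z) = p *\<^sub>R a + q *\<^sub>R b + z"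
    using pow[OF z, of m p q] by simp
  then show ?thesis by (simp add: z_def)
qed

text \<open>Up to a shift of the index these are the Chebyshev polynomials of the second kind. They are used instead of
  quotients of sines because they also make sense for \<open>c = 1\<close>, the case of an infinite entry of the Coxeter
  matrix.\<close>

fun chebyshev :: "real \<Rightarrow> nat \<Rightarrow> real" where
  "chebyshev c 0 = 0"
| "chebyshev c (Suc 0) = 1"
| "chebyshev c (Suc (Suc k)) = 2 * c * chebyshev c (Suc k) - chebyshev c k"

lemma chebyshev_sin: "sin \<theta> * chebyshev (cos \<theta>) k = sin (k * \<theta>)"
proof (induction "cos \<theta>" k rule: chebyshev.induct)
  case (3 k)
  have "sin (Suc (Suc k) * \<theta>) = sin (Suc k * \<theta> + \<theta>)" "sin (k * \<theta>) = sin (Suc k * \<theta> - \<theta>)"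
    by (simp_all add: algebra_simps)
  then have "sin (Suc (Suc k) * \<theta>) + sin (k * \<theta>) = 2 * cos \<theta> * sin (Suc k * \<theta>)"
    unfolding sin_add sin_diff by simp
  then show ?case using 3 by (simp add: algebra_simps)
qed simp_all

lemma chebyshev_one: "chebyshev 1 k = k"
  by (induction "1::real" k rule: chebyshev.induct) simp_all

text \<open>An infinite entry is encoded as \<open>m = 0\<close>, and then \<open>pi / real m = 0\<close> by the convention on division by zero, so the
  argument is \<open>cos 0 = 1\<close> as it should be.\<close>

lemma chebyshev_nonneg:
  assumes "m \<noteq> 1" "m = 0 \<or> k \<le> m"
  shows "0 \<le> chebyshev (cos (pi / real m)) k"
proof (cases "m = 0")
  case True
  then show ?thesis by (simp add: chebyshev_one)
next
  case False
  then have m: "m \<ge> 2" "k \<le> m" using assms by auto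
  have "0 < pi / m" "pi / m < pi" using m by (auto simp: field_simps)
  then have "0 < sin (pi / m)" by (rule sin_gt_zero)
  moreover have "0 \<le> sin (k * (pi / m))"
    using m by (intro sin_ge_zero) (auto simp: field_simps)
  moreover from this have "0 \<le> sin (pi / m) * chebyshev (cos (pi / m)) k"
    using chebyshev_sin[of "pi / m" k] by simp
  ultimately show ?thesis by (auto simp: zero_le_mult_iff)
qed

context coxeter_words
begin

definition simple_root :: "'a \<Rightarrow> 'a \<Rightarrow> real" where
  "simple_root s = (\<lambda>r. if r = s then 1 else 0)"

text \<open>The bilinear form with matrix \<open>- cos (\<pi> / M s t)\<close>, paired with the simple root of \<open>s\<close>. For an infinite entry,
  encoded as \<open>0\<close>, division by zero yields the usual value \<open>-1\<close>.\<close>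

definition coxeter_form :: "'a \<Rightarrow> ('a \<Rightarrow> real) \<Rightarrow> real" where
  "coxeter_form s x = (\<Sum>t\<in>S. - cos (pi / M s t) * x t)"

definition simple_reflection :: "'a \<Rightarrow> ('a \<Rightarrow> real) \<Rightarrow> ('a \<Rightarrow> real)" where
  "simple_reflection s x = x - (2 * coxeter_form s x) *\<^sub>R simple_root s"

definition geometric_action :: "'a \<Rightarrow> ('a \<Rightarrow> real) \<Rightarrow> ('a \<Rightarrow> real)" where
  "geometric_action = extended_action simple_reflection"

lemma matrix_entries:
  "s \<in> S \<Longrightarrow> M s s = 1"
  "s \<in> S \<Longrightarrow> t \<in> S \<Longrightarrow> M s t = M t s"
  "s \<in> S \<Longrightarrow> t \<in> S \<Longrightarrow> s \<noteq> t \<Longrightarrow> M s t = 0 \<or> M s t \<ge> 2"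
  using matrix by (auto simp: coxeter_matrix_def)

lemma linear_coxeter_form: "linear (coxeter_form s)"
  by (rule linearI) (simp_all add: coxeter_form_def sum.distrib[symmetric] sum_distrib_left algebra_simps)

lemma coxeter_form_simple_root: "t \<in> S \<Longrightarrow> coxeter_form s (simple_root t) = - cos (pi / M s t)"
  using finite_S by (simp add: coxeter_form_def simple_root_def if_distrib cong: if_cong)

lemma linear_simple_reflection: "linear (simple_reflection s)"
  by (rule linearI)
    (simp_all add: simple_reflection_def linear_add[OF linear_coxeter_form] linear_scale[OF linear_coxeter_form]
      algebra_simps)

lemma simple_reflection_involution:
  "s \<in> S \<Longrightarrow> simple_reflection s (simple_reflection s x) = x"
  by (simp add: simple_reflection_def linear_diff[OF linear_coxeter_form] linear_scale[OF linear_coxeter_form]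
      coxeter_form_simple_root matrix_entries algebra_simps)

lemma simple_reflections_braid_power:
  assumes "s \<in> S" "t \<in> S"
  shows "((simple_reflection s \<circ> simple_reflection t) ^^ M s t) x = x"
proof -
  consider "s = t" | "M s t = 0" | "M s t \<ge> 2" proof (cases "s = t")
    case False
    then show ?thesis using matrix_entries(3)[OF assms False] that by argo
  qed (use that in simp)
  then show ?thesis
  proof cases
    case 1
    then show ?thesis using assms matrix_entries(1) by (simp add: simple_reflection_involution)
  next
    case 3
    have "simple_reflection r = (\<lambda>x. x - (2 * coxeter_form r x) *\<^sub>R simple_root r)" for r
      by (rule ext) (simp add: simple_reflection_def)
    then show ?thesis
      using product_of_reflections_order[of "coxeter_form s" "simple_root s" "simple_root t" "M s t" "coxeter_form t" x]
        assms 3 by (simp add: linear_coxeter_form coxeter_form_simple_root matrix_entries)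
  qed simp
qed

lemmas simple_reflection_relations = simple_reflection_involution simple_reflections_braid_power

lemma geometric_action_mult:
  "g \<in> carrier W \<Longrightarrow> h \<in> carrier W \<Longrightarrow>
    geometric_action (g \<otimes> h) x = geometric_action g (geometric_action h x)"
  unfolding geometric_action_def by (rule extended_action_mult[OF simple_reflection_relations])

lemma geometric_action_one [simp]: "geometric_action \<one> x = x"
  unfolding geometric_action_def by (rule extended_action_one[OF simple_reflection_relations])

lemma geometric_action_generator: "s \<in> S \<Longrightarrow> geometric_action s x = simple_reflection s x"
  unfolding geometric_action_def by (rule extended_action_generator[OF simple_reflection_relations])

lemma generator_induct [consumes 1, case_names one mult]:
  assumes "g \<in> carrier W" "P \<one>"
    and "\<And>s g. s \<in> S \<Longrightarrow> g \<in> carrier W \<Longrightarrow> P g \<Longrightarrow> P (s \<otimes> g)"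
  shows "P g"
proof -
  have "P (list_product W ss)" if "set ss \<subseteq> S" for ss
    using that assms(2,3) by (induction ss) (auto simp: S_subset_carrier)
  then show ?thesis using generated_by_S[OF assms(1)] by blast
qed

lemma geometric_action_linear: "g \<in> carrier W \<Longrightarrow> linear (geometric_action g)"
proof (induction g rule: generator_induct)
  case one
  then show ?case by (simp add: linear_iff)
next
  case (mult s g)
  then have "geometric_action (s \<otimes> g) = simple_reflection s \<circ> geometric_action g"
    by (auto simp: geometric_action_mult geometric_action_generator)
  then show ?case using mult linear_compose linear_simple_reflection by metis
qed

definition root_space :: "('a \<Rightarrow> real) set" where
  "root_space = {x. \<forall>r. r \<notin> S \<longrightarrow> x r = 0}"

lemma root_space_subspace: "subspace root_space"
  by (auto simp: subspace_def root_space_def)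

lemma simple_root_in_root_space: "s \<in> S \<Longrightarrow> simple_root s \<in> root_space"
  by (auto simp: simple_root_def root_space_def)

lemma geometric_action_root_space: "g \<in> carrier W \<Longrightarrow> x \<in> root_space \<Longrightarrow> geometric_action g x \<in> root_space"
proof (induction g rule: generator_induct)
  case (mult s g)
  then have "geometric_action (s \<otimes> g) x = geometric_action g x - (2 * coxeter_form s (geometric_action g x)) *\<^sub>R simple_root s"
    by (simp only: geometric_action_mult geometric_action_generator simple_reflection_def S_closed)
  moreover have "geometric_action g x \<in> root_space" using mult by simp
  ultimately show ?case
    using subspace_diff[OF root_space_subspace] subspace_scale[OF root_space_subspace] simple_root_in_root_space mult by metis
qed simp

section \<open>Faithfulness of the geometric representation\<close>

definition word_length :: "'a \<Rightarrow> nat" where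
  "word_length g = (LEAST n. \<exists>ss. length ss = n \<and> set ss \<subseteq> S \<and> list_product W ss = g)"

lemma word_length_word:
  assumes "g \<in> carrier W"
  obtains ss where "length ss = word_length g" "set ss \<subseteq> S" "list_product W ss = g"
proof -
  have "\<exists>ss. length ss = word_length g \<and> set ss \<subseteq> S \<and> list_product W ss = g"
    unfolding word_length_def by (rule LeastI_ex) (use generated_by_S[OF assms] in blast)
  then obtain ss where "length ss = word_length g" "set ss \<subseteq> S" "list_product W ss = g"
    by (elim exE conjE)
  then show ?thesis by (rule that)
qed

lemma word_length_le: "set ss \<subseteq> S \<Longrightarrow> word_length (list_product W ss) \<le> length ss"
  unfolding word_length_def by (rule Least_le) blast

lemma word_length_mult_le:
  assumes "g \<in> carrier W" "s \<in> S"
  shows "word_length (g \<otimes> s) \<le> Suc (word_length g)"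
proof -
  obtain ss where ss: "length ss = word_length g" "set ss \<subseteq> S" "list_product W ss = g"
    using word_length_word[OF assms(1)] by blast
  have "list_product W (ss @ [s]) = g \<otimes> s"
    using ss assms by (simp add: list_product_append S_subset_carrier)
  then show ?thesis using word_length_le[of "ss @ [s]"] ss assms by simp
qed

lemma descent_exists:
  assumes "g \<in> carrier W" "g \<noteq> \<one>"
  obtains s where "s \<in> S" "word_length (g \<otimes> s) < word_length g"
proof -
  obtain ss where ss: "length ss = word_length g" "set ss \<subseteq> S" "list_product W ss = g"
    using word_length_word[OF assms(1)] by blast
  then obtain ss' s where ss': "ss = ss' @ [s]"
    using assms(2) by (cases ss rule: rev_cases) auto
  then have s: "s \<in> S" "set ss' \<subseteq> S" using ss by auto
  then have "g \<otimes> s = list_product W ss'"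
    using ss(3) unfolding ss' by (auto simp: list_product_append S_subset_carrier)
  then show ?thesis using that[OF s(1)] word_length_le[OF s(2)] ss(1) ss' by simp
qed

text \<open>The alternating product of \<open>k\<close> letters whose rightmost letter is \<open>t\<close>.\<close>

primrec alternating :: "'a \<Rightarrow> 'a \<Rightarrow> nat \<Rightarrow> 'a" where
  "alternating s t 0 = \<one>"
| "alternating s t (Suc k) = (if even k then t else s) \<otimes> alternating s t k"

lemma alternating_closed [simp]:
  "s \<in> S \<Longrightarrow> t \<in> S \<Longrightarrow> alternating s t k \<in> carrier W"
  by (induction k) auto

lemma word_length_mult_alternating:
  assumes "g \<in> carrier W" "s \<in> S" "t \<in> S"
  shows "word_length (g \<otimes> alternating s t k) \<le> word_length g + k"
  using assms(1)
proof (induction k arbitrary: g)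
  case (Suc k)
  define a where "a = (if even k then t else s)"
  have a: "a \<in> S" using assms by (simp add: a_def)
  have "g \<otimes> alternating s t (Suc k) = g \<otimes> a \<otimes> alternating s t k"
    using Suc.prems assms a by (simp add: m_assoc flip: a_def)
  then show ?case
    using Suc.IH[of "g \<otimes> a"] word_length_mult_le[OF Suc.prems a] Suc.prems a by simp
qed simp

text \<open>Appending a letter on the right exchanges the roles of \<open>s\<close> and \<open>t\<close>.\<close>

lemma alternating_Suc_right:
  assumes "s \<in> S" "t \<in> S"
  shows "alternating t s (Suc k) = alternating s t k \<otimes> s"
  using assms by (induction k) (auto simp: m_assoc)

lemma alternating_even_power:
  assumes "s \<in> S" "t \<in> S"
  shows "alternating s t (2 * k) = (s \<otimes> t) [^] k"
proof (induction k)
  case (Suc k)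
  have "alternating s t (2 * Suc k) = s \<otimes> t \<otimes> (s \<otimes> t) [^] k"
    using Suc assms by (simp add: m_assoc)
  then show ?case using assms by (subst nat_pow_Suc2) simp_all
qed simp

text \<open>Starting from \<open>(st)\<^sup>M = 1\<close>, a product of \<open>2M\<close> letters, each letter cancelled on the left becomes a
  letter of the alternating product ending in \<open>s\<close>.\<close>

lemma alternating_braid:
  assumes "s \<in> S" "t \<in> S"
  shows "alternating s t (M s t) = alternating t s (M s t)"
proof -
  have "alternating s t (2 * M s t - i) = alternating t s i" if "i \<le> 2 * M s t" for i
    using that
  proof (induction i)
    case 0
    then show ?case using assms by (simp add: alternating_even_power braid_power)
  next
    case (Suc i)
    define j where "j = 2 * M s t - Suc i"
    define a where "a = (if even i then s else t)"
    have a: "a \<in> S" using assms by (simp add: a_def)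
    have j: "2 * M s t - i = Suc j" "even j \<longleftrightarrow> odd i" using Suc.prems by (auto simp: j_def)
    have "alternating t s i = a \<otimes> alternating s t j"
      by (cases "even i") (use Suc j in \<open>simp_all add: a_def\<close>)
    then have "a \<otimes> alternating t s i = alternating s t j" using a assms by simp
    then show ?case by (simp add: j_def a_def)
  qed
  from this[of "M s t"] show ?thesis by simp
qed

text \<open>Each further letter changes one of the two coefficients, by a step of the Chebyshev recurrence.\<close>

lemma alternating_act:
  assumes "s \<in> S" "t \<in> S"
  defines "U \<equiv> chebyshev (cos (pi / M s t))"
  shows "geometric_action (alternating s t k) (simple_root s) =
    (if even k then U (Suc k) *\<^sub>R simple_root s + U k *\<^sub>R simple_root t
     else U k *\<^sub>R simple_root s + U (Suc k) *\<^sub>R simple_root t)"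
proof (induction k)
  case 0
  then show ?case by (simp add: U_def)
next
  case (Suc k)
  have U: "U (Suc (Suc k)) = 2 * cos (pi / M s t) * U (Suc k) - U k" by (simp add: U_def)
  have step: "simple_reflection s (p *\<^sub>R simple_root s + q *\<^sub>R simple_root t)
      = (2 * cos (pi / M s t) * q - p) *\<^sub>R simple_root s + q *\<^sub>R simple_root t"
    "simple_reflection t (p *\<^sub>R simple_root s + q *\<^sub>R simple_root t)
      = p *\<^sub>R simple_root s + (2 * cos (pi / M s t) * p - q) *\<^sub>R simple_root t" for p q
    using assms matrix_entries(1) matrix_entries(2)[OF assms(1,2)]
    by (simp_all add: fun_eq_iff simple_reflection_def linear_add[OF linear_coxeter_form]
        linear_scale[OF linear_coxeter_form] coxeter_form_simple_root algebra_simps)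
  show ?case
    using Suc assms(1,2) by (simp add: geometric_action_mult geometric_action_generator step U del: scaleR_fun_apply)
qed

text \<open>Tits' theorem. Let \<open>t\<close> be a letter that shortens \<open>g\<close>, so \<open>t \<noteq> s\<close>, and split off from \<open>g\<close> an alternating product
  in \<open>s\<close> and \<open>t\<close>, ending in \<open>t\<close>, of maximal length \<open>k \<le> m = M s t\<close> (any \<open>k\<close> if the entry is infinite), so that
  \<open>g = v \<cdot> alternating s t k\<close> with lengths adding up. Here \<open>k = m\<close> is impossible, since the alternating product
  could be rewritten to end in \<open>s\<close>, and \<open>s\<close> would shorten \<open>g\<close>. Hence neither \<open>s\<close> nor \<open>t\<close> shortens \<open>v\<close>, one by
  maximality of \<open>k\<close> and the other because lengths add up, and \<open>v\<close> maps both simple roots to nonnegative vectors by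
  induction. As \<open>k < m\<close>, the alternating product maps the root of \<open>s\<close> to a nonnegative combination of the two.\<close>

lemma longer_imp_positive_root:
  assumes "g \<in> carrier W" "s \<in> S" "word_length g \<le> word_length (g \<otimes> s)"
  shows "0 \<le> geometric_action g (simple_root s) r"
  using assms
proof (induction "word_length g" arbitrary: g s rule: less_induct)
  case less
  note g = less.prems(1) and s = less.prems(2)
  show ?case
  proof (cases "g = \<one>")
    case True
    then show ?thesis by (simp add: simple_root_def)
  next
    case False
    obtain t where t: "t \<in> S" "word_length (g \<otimes> t) < word_length g"
      using descent_exists[OF g False] by blast
    have st: "s \<noteq> t" using t less.prems(3) by auto
    define m where "m = M s t"
    have m1: "m \<noteq> 1" using matrix_entries(3)[OF s t(1) st] by (auto simp: m_def)
    define ok where "ok k \<longleftrightarrow> (m = 0 \<or> k \<le> m) \<and>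
      (\<exists>v\<in>carrier W. g = v \<otimes> alternating s t k \<and> word_length v + k = word_length g)" for k
    have "word_length g \<le> Suc (word_length (g \<otimes> t))"
      using word_length_mult_le[of "g \<otimes> t" t] g t(1) by simp
    then have "ok 1"
      unfolding ok_def using m1 t g by (intro conjI bexI[of _ "g \<otimes> t"]) auto
    have bound: "j \<le> word_length g" if "ok j" for j using that by (auto simp: ok_def)
    define k where "k = (GREATEST k. ok k)"
    have k: "ok k"
      unfolding k_def by (rule GreatestI_nat[of ok 1 "word_length g"]) (use \<open>ok 1\<close> bound in auto)
    have k_max: "j \<le> k" if "ok j" for j
      unfolding k_def by (rule Greatest_le_nat[of ok j "word_length g"]) (use that bound in auto)
    have k1: "k \<ge> 1" using k_max[OF \<open>ok 1\<close>] .
    from k[unfolded ok_def] have km: "m = 0 \<or> k \<le> m" ..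
    from k[unfolded ok_def] obtain v where v: "v \<in> carrier W" "g = v \<otimes> alternating s t k"
      "word_length v + k = word_length g" by (elim conjE bexE)
    have "k \<noteq> m"
    proof
      assume "k = m"
      obtain k' where k': "k = Suc k'" using k1 by (cases k) auto
      then have "M s t = Suc k'" using \<open>k = m\<close> unfolding m_def by linarith
      then have "alternating s t k = alternating s t k' \<otimes> s"
        using alternating_braid[OF s t(1)] alternating_Suc_right[OF s t(1)] k' by metis
      then have "g \<otimes> s = v \<otimes> (alternating s t k' \<otimes> s) \<otimes> s" using v(2) by metis
      also have "\<dots> = v \<otimes> alternating s t k'"
        using v(1) s t(1) by (simp add: m_assoc S_square)
      finally have "g \<otimes> s = v \<otimes> alternating s t k'" .
      then have "word_length (g \<otimes> s) \<le> word_length v + k'"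
        using word_length_mult_alternating[OF v(1) s t(1)] by simp
      then show False using v(3) k' less.prems(3) by linarith
    qed
    then have km': "m = 0 \<or> Suc k \<le> m" using km by auto
    define a b where "a = (if even k then t else s)" and "b = (if even k then s else t)"
    have ab: "a \<in> S" "b \<in> S" using s t by (auto simp: a_def b_def)
    have shorter: "word_length v < word_length g" using v(3) k1 by simp
    have "word_length v \<le> word_length (v \<otimes> a)"
    proof (rule ccontr)
      assume "\<not> ?thesis"
      moreover have "word_length v \<le> Suc (word_length (v \<otimes> a))"
        using word_length_mult_le[of "v \<otimes> a" a] v(1) ab by simp
      ultimately have "word_length (v \<otimes> a) + Suc k = word_length g" using v(3) by simp
      moreover have "g = v \<otimes> a \<otimes> alternating s t (Suc k)"
      proof -
        have "alternating s t (Suc k) = a \<otimes> alternating s t k" by (simp add: a_def)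
        then have "v \<otimes> a \<otimes> alternating s t (Suc k) = v \<otimes> (a \<otimes> (a \<otimes> alternating s t k))"
          using v(1) ab s t(1) by (simp add: m_assoc)
        then show ?thesis using v(2) ab s t(1) by simp
      qed
      ultimately have "ok (Suc k)"
        unfolding ok_def using km' v(1) ab by (intro conjI bexI[of _ "v \<otimes> a"]) auto
      then show False using k_max[of "Suc k"] by simp
    qed
    moreover have "word_length v \<le> word_length (v \<otimes> b)"
    proof -
      obtain k' where k': "k = Suc k'" using k1 by (cases k) auto
      then have "alternating s t k = b \<otimes> alternating s t k'" by (simp add: b_def)
      then have "g = v \<otimes> b \<otimes> alternating s t k'"
        using v(1,2) ab s t(1) by (simp add: m_assoc)
      moreover have "word_length (v \<otimes> b \<otimes> alternating s t k') \<le> word_length (v \<otimes> b) + k'"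
        using v(1) ab s t(1) by (intro word_length_mult_alternating) simp_all
      ultimately show ?thesis using v(3) k' by simp
    qed
    ultimately have "0 \<le> geometric_action v (simple_root a) r" "0 \<le> geometric_action v (simple_root b) r"
      using less.hyps[OF shorter v(1)] ab by blast+
    then have pos: "0 \<le> geometric_action v (simple_root s) r" "0 \<le> geometric_action v (simple_root t) r"
      unfolding a_def b_def by presburger+
    define U where "U = chebyshev (cos (pi / m))"
    have U: "0 \<le> U k" "0 \<le> U (Suc k)"
      using chebyshev_nonneg[OF m1, of k] chebyshev_nonneg[OF m1, of "Suc k"] km km'
      by (auto simp: U_def)
    have combination: "0 \<le> geometric_action v (p *\<^sub>R simple_root s + q *\<^sub>R simple_root t) r"
      if "0 \<le> p" "0 \<le> q" for p q
      using that pos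
      by (simp add: linear_add[OF geometric_action_linear[OF v(1)]] linear_scale[OF geometric_action_linear[OF v(1)]])
    have "geometric_action g (simple_root s) = geometric_action v (geometric_action (alternating s t k) (simple_root s))"
      unfolding v(2) using v(1) s t(1) by (intro geometric_action_mult) simp_all
    then show ?thesis
      unfolding alternating_act[OF s t(1), of k] m_def[symmetric] U_def[symmetric]
      using combination U by presburger
  qed
qed

text \<open>If \<open>s\<close> shortens \<open>g\<close>, then \<open>gs\<close> maps the simple root of \<open>s\<close> to a nonnegative vector, so \<open>g\<close> maps it to a
  nonpositive one and does not fix it.\<close>

lemma geometric_action_faithful:
  assumes "g \<in> carrier W" and trivial: "\<And>x. x \<in> root_space \<Longrightarrow> geometric_action g x = x"
  shows "g = \<one>"
proof (rule ccontr)
  assume "g \<noteq> \<one>"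
  then obtain s where s: "s \<in> S" "word_length (g \<otimes> s) < word_length g"
    using descent_exists[OF assms(1)] by blast
  have gs: "g \<otimes> s \<in> carrier W" using assms(1) s by simp
  have "0 \<le> geometric_action (g \<otimes> s) (simple_root s) s"
    using longer_imp_positive_root[OF gs s(1)] s assms(1) by simp
  also have "geometric_action (g \<otimes> s) (simple_root s) = geometric_action g (- simple_root s)"
    using assms(1) s by (simp add: geometric_action_mult geometric_action_generator simple_reflection_def coxeter_form_simple_root
        matrix_entries scaleR_2)
  also have "\<dots> = - simple_root s"
    using linear_neg[OF geometric_action_linear[OF assms(1)]] trivial[OF simple_root_in_root_space[OF s(1)]] by simp
  finally show False by (simp add: simple_root_def)
qed

section \<open>The averaged inner product\<close>

text \<open>Averaging the standard inner product over \<open>W\<close> makes every element of \<open>W\<close> an isometry of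
  \<open>root_space\<close>.\<close>

definition averaged_form :: "('a \<Rightarrow> real) \<Rightarrow> ('a \<Rightarrow> real) \<Rightarrow> real" where
  "averaged_form x y = (\<Sum>g\<in>carrier W. \<Sum>r\<in>S. geometric_action g x r * geometric_action g y r)"

lemma averaged_form_sym: "averaged_form x y = averaged_form y x"
  by (simp add: averaged_form_def mult.commute)

lemma averaged_form_add: "averaged_form (x + y) z = averaged_form x z + averaged_form y z"
  unfolding averaged_form_def sum.distrib[symmetric]
  by (intro sum.cong HOL.refl) (simp add: linear_add[OF geometric_action_linear] algebra_simps)

lemma averaged_form_scale: "averaged_form (c *\<^sub>R x) z = c * averaged_form x z"
  unfolding averaged_form_def sum_distrib_left
  by (intro sum.cong HOL.refl) (simp add: linear_scale[OF geometric_action_linear] algebra_simps)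

lemma averaged_form_nonneg: "0 \<le> averaged_form x x"
  unfolding averaged_form_def by (intro sum_nonneg) simp

lemma averaged_form_definite:
  assumes "x \<in> root_space" "averaged_form x x = 0"
  shows "x = 0"
proof
  fix r
  have "\<forall>g\<in>carrier W. (\<Sum>r\<in>S. geometric_action g x r * geometric_action g x r) = 0"
    using assms(2) finite_W unfolding averaged_form_def
    by (subst (asm) sum_nonneg_eq_0_iff) (auto intro: sum_nonneg)
  then have "(\<Sum>r\<in>S. geometric_action \<one> x r * geometric_action \<one> x r) = 0" using one_closed by (rule bspec)
  then have "x r = 0" if "r \<in> S"
    using that finite_S by (subst (asm) sum_nonneg_eq_0_iff) auto
  then show "x r = 0 r" using assms(1) by (auto simp: root_space_def)
qed

lemma geometric_action_isometry:
  assumes "h \<in> carrier W"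
  shows "averaged_form (geometric_action h x) (geometric_action h y) = averaged_form x y"
proof -
  have "averaged_form (geometric_action h x) (geometric_action h y) = (\<Sum>g\<in>carrier W. \<Sum>r\<in>S. geometric_action (g \<otimes> h) x r * geometric_action (g \<otimes> h) y r)"
    unfolding averaged_form_def using assms by (intro sum.cong) (simp_all add: geometric_action_mult)
  also have "\<dots> = averaged_form x y"
    unfolding averaged_form_def
    by (rule sum.reindex_bij_witness[of _ "\<lambda>g. g \<otimes> inv h" "\<lambda>g. g \<otimes> h"])
      (use assms in \<open>auto simp: m_assoc\<close>)
  finally show ?thesis .
qed

text \<open>An isometry that negates a vector \<open>d\<close> and moves every vector by a multiple of \<open>d\<close> is the orthogonal reflection in
  \<open>d\<close>, with respect to any invariant form.\<close>

lemma simple_unit_root: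
  assumes "s \<in> S"
  shows "\<exists>a\<in>root_space. averaged_form a a = 1 \<and> (\<forall>x. geometric_action s x = x - (2 * averaged_form a x) *\<^sub>R a)"
proof -
  let ?d = "simple_root s"
  define n where "n = averaged_form ?d ?d"
  have averaged_form_add2: "averaged_form z (x + y) = averaged_form z x + averaged_form z y" for x y z by (metis averaged_form_sym averaged_form_add)
  have averaged_form_scale2: "averaged_form z (c *\<^sub>R x) = c * averaged_form z x" for c x z by (metis averaged_form_sym averaged_form_scale)
  have "n \<noteq> 0"
  proof
    assume "n = 0"
    then have "?d = 0" using averaged_form_definite[OF simple_root_in_root_space[OF assms]] by (simp add: n_def)
    from fun_cong[OF this, of s] show False by (simp add: simple_root_def)
  qed
  then have n: "n > 0" using averaged_form_nonneg[of ?d] by (simp add: n_def)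
  have coxeter_form: "coxeter_form s x * n = averaged_form ?d x" for x
  proof -
    have "geometric_action s ?d = (- 1) *\<^sub>R ?d"
      using assms by (simp add: geometric_action_generator simple_reflection_def coxeter_form_simple_root matrix_entries
          scaleR_2)
    moreover have "geometric_action s x = x + (- 2 * coxeter_form s x) *\<^sub>R ?d"
      using assms by (simp add: geometric_action_generator simple_reflection_def)
    ultimately have "averaged_form ((- 1) *\<^sub>R ?d) (x + (- 2 * coxeter_form s x) *\<^sub>R ?d) = averaged_form ?d x"
      using geometric_action_isometry[of s ?d x] assms by simp
    then show ?thesis unfolding averaged_form_scale averaged_form_scale2 averaged_form_add2 by (simp add: n_def)
  qed
  define a where "a = (1 / sqrt n) *\<^sub>R ?d"
  have "a \<in> root_space" unfolding a_def by (intro subspace_scale root_space_subspace simple_root_in_root_space assms)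
  moreover have "averaged_form a a = 1" using n by (simp add: a_def averaged_form_scale averaged_form_scale2 flip: n_def)
  moreover have "geometric_action s x = x - (2 * averaged_form a x) *\<^sub>R a" for x
    using n assms coxeter_form[of x]
    by (simp add: a_def averaged_form_scale geometric_action_generator simple_reflection_def field_simps)
  ultimately show ?thesis by blast
qed

lemma unit_root:
  assumes "t \<in> reflections W S"
  shows "\<exists>a\<in>root_space. averaged_form a a = 1 \<and> (\<forall>x. geometric_action t x = x - (2 * averaged_form a x) *\<^sub>R a)"
proof -
  obtain g s where g: "g \<in> carrier W" and s: "s \<in> S" and t: "t = g \<otimes> s \<otimes> inv g"
    using assms by (auto simp: reflections_def)
  obtain a where a: "a \<in> root_space" "averaged_form a a = 1" "\<And>x. geometric_action s x = x - (2 * averaged_form a x) *\<^sub>R a"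
    using simple_unit_root[OF s] by blast
  have cancel: "geometric_action g (geometric_action (inv g) x) = x" for x using g by (simp flip: geometric_action_mult)
  have "geometric_action t x = x - (2 * averaged_form (geometric_action g a) x) *\<^sub>R geometric_action g a" for x
  proof -
    have "geometric_action t x = geometric_action g (geometric_action s (geometric_action (inv g) x))" using g s by (simp add: t geometric_action_mult)
    also have "\<dots> = x - (2 * averaged_form a (geometric_action (inv g) x)) *\<^sub>R geometric_action g a"
      by (simp only: a(3) linear_diff[OF geometric_action_linear[OF g]] linear_scale[OF geometric_action_linear[OF g]] cancel)
    also have "averaged_form a (geometric_action (inv g) x) = averaged_form (geometric_action g a) x"
      using geometric_action_isometry[OF g, of a "geometric_action (inv g) x"] cancel by simp
    finally show ?thesis .
  qed
  moreover have "geometric_action g a \<in> root_space" "averaged_form (geometric_action g a) (geometric_action g a) = 1"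
    using a g by (simp_all add: geometric_action_root_space geometric_action_isometry)
  ultimately show ?thesis by blast
qed

text \<open>Two reflections \<open>t\<close> and \<open>r\<close> with the same action agree because \<open>rt\<close> then acts trivially.\<close>

theorem euclidean_reflection_representation:
  "\<exists>root. euclidean_reflections W (reflections W S) root_space averaged_form geometric_action root"
proof -
  obtain root where root: "\<forall>t\<in>reflections W S. root t \<in> root_space \<and>
      averaged_form (root t) (root t) = 1 \<and>
      (\<forall>x. geometric_action t x = x - (2 * averaged_form (root t) x) *\<^sub>R root t)"
    using bchoice[of "reflections W S"] unit_root by (metis (no_types, lifting))
  have "euclidean_reflections W (reflections W S) root_space averaged_form geometric_action root"
  proof (intro euclidean_reflections.intro involution_class.intro involution_class_axioms.intro
      euclidean_reflections_axioms.intro)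
    show "root t \<in> root_space" "averaged_form (root t) (root t) = 1"
      "geometric_action t x = x - (2 * averaged_form (root t) x) *\<^sub>R root t"
      if "t \<in> reflections W S" for t x
      using root that by blast+
    show "reflections W S \<subseteq> carrier W" using reflections_carrier[OF system] by blast
    show "t = r" if t: "t \<in> reflections W S" and r: "r \<in> reflections W S"
      and eq: "\<And>x. x \<in> root_space \<Longrightarrow> geometric_action t x = geometric_action r x" for t r
    proof -
      have c: "t \<in> carrier W" "r \<in> carrier W" "r \<otimes> r = \<one>"
        using t r reflections_carrier[OF system] reflections_square[OF system] by auto
      have "geometric_action (r \<otimes> t) x = x" if "x \<in> root_space" for x
        using c eq[OF that] geometric_action_mult[of r t x] geometric_action_mult[of r r x] by simp
      then have "r \<otimes> t = \<one>" using c by (intro geometric_action_faithful) simp_all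
      then show "t = r" using c by (metis inv_equality inv_inv)
    qed
  qed (fact group_axioms finite_W root_space_subspace averaged_form_sym averaged_form_add averaged_form_scale averaged_form_nonneg averaged_form_definite
      geometric_action_linear geometric_action_one geometric_action_mult geometric_action_root_space geometric_action_isometry
      reflections_square[OF system] reflections_conj[OF system])+
  then show ?thesis by blast
qed

end

theorem theorem1p1:
  fixes W :: "('a, 'b) monoid_scheme" and S :: "'a set" and k m :: nat
    and w :: 'a and ts :: "'a list"
  assumes "coxeter_system W S" and "finite (carrier W)"
    and "w \<in> carrier W"
    and "m = reflection_length W S w"
    and "length ts = m + 2 * k"
    and "reflection_factorization W S w ts"
  shows "\<exists>\<sigma>\<in>carrier (braid_group (m + 2 * k)). \<exists>rs qs.
    length rs = m \<and> set rs \<subseteq> reflections W S \<and>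
    length qs = k \<and> set qs \<subseteq> reflections W S \<and>
    hurwitz_action W \<sigma> ts = rs @ concat (map (\<lambda>q. [q, q]) qs)"
proof -
  obtain M ev where "coxeter_words W S M ev"
  proof (rule coxeter_system_words[OF assms(1)])
    fix M ev
    assume "coxeter_matrix S M" "\<And>u. u \<in> gwords S \<Longrightarrow> ev u \<in> carrier W"
      "\<And>w. w \<in> carrier W \<Longrightarrow> \<exists>u\<in>gwords S. ev u = w"
      "\<And>u v. u \<in> gwords S \<Longrightarrow> v \<in> gwords S \<Longrightarrow> ev (u @ v) = ev u \<otimes>\<^bsub>W\<^esub> ev v"
      "\<And>s. s \<in> S \<Longrightarrow> ev [(s, True)] = s"
      "\<And>u v. u \<in> gwords S \<Longrightarrow> v \<in> gwords S \<Longrightarrow>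
        ev u = ev v \<longleftrightarrow> (u, v) \<in> presentation_rel S (coxeter_relations S M)"
    then have "coxeter_words W S M ev"
      using assms(1,2) unfolding coxeter_words_def coxeter_words_axioms_def coxeter_system_def by blast
    then show thesis by (rule that)
  qed
  then interpret coxeter_words W S M ev .
  obtain root where
    "euclidean_reflections W (reflections W S) root_space averaged_form geometric_action root"
    using euclidean_reflection_representation by blast
  then interpret E: euclidean_reflections W "reflections W S" root_space averaged_form
    geometric_action root .
  have "\<exists>us. length us = m \<and> reflection_factorization W S w us"
    unfolding assms(4) reflection_length_def by (rule LeastI_ex) (use assms(6) in blast)
  then obtain us where us: "length us = m" "set us \<subseteq> reflections W S" "list_product W us = w"
    by (auto simp: reflection_factorization_def)
  have "length vs \<le> m" if "set vs \<subseteq> reflections W S" "repeat_free W vs" "list_product W vs = w" for vs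
    using E.repeat_free_length_le[OF that(1,2) us(2)] us(1,3) that(3) by simp
  then obtain rs qs where "length rs = m" "set rs \<subseteq> reflections W S"
    "length qs = k" "set qs \<subseteq> reflections W S"
    and moves: "hurwitz_moves W ts (rs @ concat (map (\<lambda>q. [q, q]) qs))"
    using E.repeats_collect_right[of w m ts k] assms(5,6)
    unfolding reflection_factorization_def by blast
  moreover obtain \<sigma> where "\<sigma> \<in> carrier (braid_group (m + 2 * k))"
    "hurwitz_action W \<sigma> ts = rs @ concat (map (\<lambda>q. [q, q]) qs)"
    using hurwitz_moves_action[OF assms(1) _ assms(5) moves] assms(6)
    unfolding reflection_factorization_def by blast
  ultimately show ?thesis by blast
qed

end
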